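(* Let $A$ and $B$ be two finite subsets of $\mathbb{Z}^2$, each containing at least two points, which are not translation copies of each other. If $A$ and $B$ do not share a stable direction, then the smallest possible size of a percolating seed for the collection of patterns $\{A, B\}$ equals $\operatorname{mix}(\operatorname{conv} A, \operatorname{conv} B)$. If $A$ and $B$ do share a stable direction, then no finite percolating seed for $\{A, B\}$ exists.
   Context: Let $\mathcal{A}$ be a finite collection of finite subsets of $\mathbb{Z}^d$, called patterns (here $d = 2$). A seed is any subset $S$ of $\mathbb{Z}^d$. Consider the following process. At each moment, every point of $\mathbb{Z}^d$ is either occupied or vacant; initially exactly the points of $S$ are occupied. A point completes a subset of $\mathbb{Z}^d$ if it is the unique vacant point in that subset. On each step, all vacant points which complete a translation copy (by a vector of $\mathbb{Z}^d$) of some pattern in $\mathcal{A}$ become occupied simultaneously; once a point is occupied it stays occupied. The seed $S$ percolates (is a percolating seed for $\mathcal{A}$) if every point of $\mathbb{Z}^d$ eventually becomes occupied. A stable direction shared by $A$ and $B$ is a unit vector $\mathbf{u} \in \mathbb{R}^2$ which occurs as an outward unit normal of a side in both of the convex hulls $\operatorname{conv} A$ and $\operatorname{conv} B$; when a convex hull is a segment, both unit vectors perpendicular to it count as outward unit normals. (Equivalently, the linear functional $\mathbf{a} \mapsto \mathbf{u} \cdot \mathbf{a}$ attains its maximum over $A$ at two or more points of $A$, and likewise for $B$.) For convex polygons $F$ and $G$ in $\mathbb{R}^2$ (possibly degenerate), the mixed volume is $\operatorname{mix}(F, G) = \operatorname{vol}(F + G) - \operatorname{vol} F - \operatorname{vol}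 G$, where $F + G$ is the Minkowski sum and $\operatorname{vol}$ is area. *)

theory Defs
  imports "HOL-Analysis.Analysis"
begin

definition completes :: "'a set \<Rightarrow> 'a \<Rightarrow> 'a set \<Rightarrow> bool" where
  "completes Occ p X \<longleftrightarrow> X - Occ = {p}"

definition perc_step :: "'a::ab_group_add set set \<Rightarrow> 'a set \<Rightarrow> 'a set" where
  "perc_step \<A> Occ = Occ \<union> {p. \<exists>P\<in>\<A>. \<exists>v. completes Occ p ((+) v ` P)}"

definition percolates :: "'a::ab_group_add set set \<Rightarrow> 'a set \<Rightarrow> bool" where
  "percolates \<A> S \<longleftrightarrow> (\<forall>p. \<exists>n. p \<in> (perc_step \<A> ^^ n) S)"

text \<open>Only finite seeds are compared: \<^const>\<open>card\<close> of an infinite set is 0.\<close>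

definition smallest_seed_size :: "'a::ab_group_add set set \<Rightarrow> real \<Rightarrow> bool" where
  "smallest_seed_size \<A> m \<longleftrightarrow>
     (\<exists>S. finite S \<and> percolates \<A> S \<and> real (card S) = m) \<and>
     (\<forall>S. finite S \<and> percolates \<A> S \<longrightarrow> m \<le> real (card S))"

definition lattice_hull :: "(int \<times> int) set \<Rightarrow> (real \<times> real) set" where
  "lattice_hull A = convex hull (map_prod real_of_int real_of_int ` A)"

text \<open>
  A segment is an edge of itself, so for a segment \<open>K\<close> the definition yields both
  unit vectors perpendicular to it, as intended.
\<close>

definition outward_unit_normal :: "real \<times> real \<Rightarrow> (real \<times> real) set \<Rightarrow> bool" where
  "outward_unit_normal u K \<longleftrightarrow>
     norm u = 1 \<and>
     (\<exists>E c. E edge_of K \<and> (\<forall>x\<in>E. u \<bullet> x = c) \<and> (\<forall>x\<in>K. u \<bullet> x \<le> c))"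

definition shared_stable_direction ::
    "(int \<times> int) set \<Rightarrow> (int \<times> int) set \<Rightarrow> real \<times> real \<Rightarrow> bool" where
  "shared_stable_direction A B u \<longleftrightarrow>
     outward_unit_normal u (lattice_hull A) \<and> outward_unit_normal u (lattice_hull B)"

text \<open>The sum \<open>F + G\<close> of sets is the Minkowski sum.\<close>

definition mix :: "(real \<times> real) set \<Rightarrow> (real \<times> real) set \<Rightarrow> real" where
  "mix F G = measure lborel (F + G) - measure lborel F - measure lborel G"

end

theory Submission
  imports Defs
begin

text \<open>
  Lower bound. Over the two-element field, a seed \<open>S\<close> that percolates inside a finite region \<open>R\<close>
  satisfies \<open>|R| - |F| - |G| + |H| \<le> |S|\<close>, where \<open>F\<close>, \<open>G\<close> and \<open>H\<close> are the sets of translates of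
  \<open>A\<close>, \<open>B\<close> and \<open>A + B\<close> inside \<open>R\<close>.

  Upper bound. Let \<open>X = conv A + conv B\<close>, moved by a generic real shift \<open>s\<close>, and let it grow from a
  point to the whole plane through homothetic copies \<open>t X\<close> about an interior point. Each side of \<open>X\<close> is
  parallel to a side of exactly one of the two patterns, so the other pattern has a single topmost
  point there; let the translates of that other pattern supply new points at that side, and let the
  points which cannot be supplied in this way be the seeds. For \<open>t \<ge> 1\<close> everything is supplied. For
  \<open>t < 1\<close> no translate of a pattern fits with a whole edge on a side of \<open>t X\<close>, so every translate
  inside \<open>X\<close> supplies exactly one point and the number of seeds is the number of lattice points in
  the shifted copy of \<open>X\<close> minus those in the shifted copies of \<open>conv A\<close> and \<open>conv B\<close>.

  Comparing both regimes with the lower bound for a large region \<open>t X\<close> shows that these seeds are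
  minimal. Hence their number does not depend on \<open>s\<close>, and averaging over \<open>s\<close> in the unit square
  turns lattice point counts into areas, which gives the mixed volume.
\<close>

subsection \<open>Percolation inside a region\<close>

text \<open>Occupation is monotone, so the simultaneous steps can be replaced by an unordered
  closure with rule induction. Every translate used has to lie inside \<open>R\<close>, which lets
  percolation be counted in a finite region.\<close>

inductive_set derivable :: "'a::ab_group_add set set \<Rightarrow> 'a set \<Rightarrow> 'a set \<Rightarrow> 'a set"
  for \<A> R S where
  seed: "p \<in> S \<Longrightarrow> p \<in> R \<Longrightarrow> p \<in> derivable \<A> R S"
| fill: "P \<in> \<A> \<Longrightarrow> (+) v ` P \<subseteq> R \<Longrightarrow> p \<in> (+) v ` P \<Longrightarrow>
    (\<And>x. x \<in> (+) v ` P \<Longrightarrow> x \<noteq> p \<Longrightarrow> x \<in> derivable \<A> R S) \<Longrightarrow> p \<in> derivable \<A> R S"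

lemma perc_step_pow_mono:
  assumes "m \<le> n"
  shows "(perc_step \<A> ^^ m) S \<subseteq> (perc_step \<A> ^^ n) S"
proof (rule lift_Suc_mono_le[OF _ assms])
  show "(perc_step \<A> ^^ k) S \<subseteq> (perc_step \<A> ^^ Suc k) S" for k
    by (auto simp: perc_step_def)
qed

lemma percolates_imp_derivable:
  assumes "percolates \<A> S"
  shows "p \<in> derivable \<A> UNIV S"
proof -
  have "(perc_step \<A> ^^ n) S \<subseteq> derivable \<A> UNIV S" for n
  proof (induction n)
    case 0
    then show ?case by (auto intro: derivable.seed)
  next
    case (Suc n)
    show ?case
    proof
      fix p assume "p \<in> (perc_step \<A> ^^ Suc n) S"
      then consider "p \<in> (perc_step \<A> ^^ n) S"
        | P v where "P \<in> \<A>" "(+) v ` P - (perc_step \<A> ^^ n) S = {p}"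
        by (auto simp: perc_step_def completes_def)
      then show "p \<in> derivable \<A> UNIV S"
      proof cases
        case 1
        then show ?thesis using Suc by blast
      next
        case 2
        show ?thesis
        proof (rule derivable.fill[OF 2(1), of v])
          show "p \<in> (+) v ` P" using 2(2) by blast
          fix x assume "x \<in> (+) v ` P" "x \<noteq> p"
          then have "x \<in> (perc_step \<A> ^^ n) S" using 2(2) by blast
          then show "x \<in> derivable \<A> UNIV S" using Suc by blast
        qed simp
      qed
    qed
  qed
  then show ?thesis using assms unfolding percolates_def by blast
qed

lemma derivable_imp_percolates:
  assumes fin: "\<And>P. P \<in> \<A> \<Longrightarrow> finite P" and all: "\<And>p. p \<in> derivable \<A> UNIV S"
  shows "percolates \<A> S"
proof -
  have "\<exists>n. p \<in> (perc_step \<A> ^^ n) S" if "p \<in> derivable \<A> UNIV S" for p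
    using that
  proof induction
    case (seed p)
    then have "p \<in> (perc_step \<A> ^^ 0) S" by simp
    then show ?case by blast
  next
    case (fill P v p)
    let ?X = "(+) v ` P - {p}"
    have "\<forall>x\<in>?X. \<exists>n. x \<in> (perc_step \<A> ^^ n) S" using fill by blast
    then obtain f where f: "\<And>x. x \<in> ?X \<Longrightarrow> x \<in> (perc_step \<A> ^^ f x) S" by metis
    have finX: "finite ?X" using fin fill by auto
    \<comment> \<open>\<open>insert 0\<close> keeps the maximum defined when \<open>p\<close> is the
      only point of the translate.\<close>
    define n where "n = Max (insert 0 (f ` ?X))"
    have "f x \<le> n" if "x \<in> ?X" for x
      using that finX by (auto simp: n_def)
    then have X: "?X \<subseteq> (perc_step \<A> ^^ n) S"
      using f perc_step_pow_mono[of _ n \<A> S] by blast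
    have "p \<in> (perc_step \<A> ^^ Suc n) S"
    proof (cases "p \<in> (perc_step \<A> ^^ n) S")
      case True
      then show ?thesis using perc_step_pow_mono[of n "Suc n" \<A> S] by auto
    next
      case False
      then have "completes ((perc_step \<A> ^^ n) S) p ((+) v ` P)"
        using X fill by (auto simp: completes_def)
      then show ?thesis using fill(1) by (auto simp: perc_step_def)
    qed
    then show ?case by blast
  qed
  then show ?thesis using all by (auto simp: percolates_def)
qed

lemma derivable_mono:
  assumes "R \<subseteq> R'" "p \<in> derivable \<A> R S"
  shows "p \<in> derivable \<A> R' S"
  using assms(2)
proof induction
  case (seed p)
  then show ?case using assms by (auto intro: derivable.seed)
next
  case (fill P v p)
  show ?case by (rule derivable.fill[OF fill(1), of v]) (use fill assms(1) in auto)
qed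

text \<open>A derivation uses only finitely many translates of finite patterns, so \<open>h\<close>
  is bounded on them.\<close>

lemma derivable_in_sublevel:
  fixes h :: "'a::ab_group_add \<Rightarrow> real"
  assumes fin: "\<And>P. P \<in> \<A> \<Longrightarrow> finite P" and p: "p \<in> derivable \<A> UNIV S"
  shows "\<exists>T. p \<in> derivable \<A> {x. h x \<le> T} S"
  using p
proof induction
  case (seed p)
  then have "p \<in> derivable \<A> {x. h x \<le> h p} S" by (auto intro: derivable.seed)
  then show ?case by blast
next
  case (fill P v p)
  let ?X = "(+) v ` P"
  have "\<forall>x\<in>?X - {p}. \<exists>T. x \<in> derivable \<A> {x. h x \<le> T} S" using fill by blast
  then obtain f where f: "\<And>x. x \<in> ?X - {p} \<Longrightarrow> x \<in> derivable \<A> {y. h y \<le> f x} S" by metis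
  have finX: "finite ?X" using fin fill by auto
  define T where "T = Max (f ` ?X \<union> h ` ?X)"
  have T: "f x \<le> T" "h x \<le> T" if "x \<in> ?X" for x
    using that finX unfolding T_def by (auto intro!: Max_ge)
  have X: "x \<in> derivable \<A> {x. h x \<le> T} S" if "x \<in> ?X" "x \<noteq> p" for x
    using f[of x] that T(1)[OF that(1)] by (auto intro: derivable_mono[rotated])
  have "p \<in> derivable \<A> {x. h x \<le> T} S"
  proof (rule derivable.fill[OF fill(1), where v = v])
    show "(+) v ` P \<subseteq> {x. h x \<le> T}" using T(2) by blast
  qed (use fill X in auto)
  then show ?case by blast
qed

subsection \<open>The parity bound\<close>

text \<open>Singles out a leading point of \<open>B\<close>. Coordinates are read as digits to a
  base \<open>M\<close> larger than any difference of second coordinates in \<open>B\<close>, so the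
  additive map is injective on \<open>B\<close> and its maximum is attained only once.\<close>

lemma ex_additive_strict_max:
  fixes B :: "(int \<times> int) set"
  assumes "finite B" "B \<noteq> {}"
  obtains b0 :: "int \<times> int" and f :: "int \<times> int \<Rightarrow> int"
  where "b0 \<in> B" "\<And>x y. f (x + y) = f x + f y" "\<And>b. b \<in> B \<Longrightarrow> b \<noteq> b0 \<Longrightarrow> f b < f b0"
proof -
  define M where "M = 1 + 2 * Max ((\<lambda>b. \<bar>snd b\<bar>) ` B)"
  have M: "2 * \<bar>snd b\<bar> < M" if "b \<in> B" for b
  proof -
    have "\<bar>snd b\<bar> \<le> Max ((\<lambda>b. \<bar>snd b\<bar>) ` B)" using that assms by (intro Max_ge) auto
    then show ?thesis by (simp add: M_def)
  qed
  define f where "f = (\<lambda>x :: int \<times> int. M * fst x + snd x)"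
  have inj: "b = b'" if "b \<in> B" "b' \<in> B" "f b = f b'" for b b'
  proof -
    have eq: "M * (fst b - fst b') = snd b' - snd b"
      using that by (simp add: f_def algebra_simps)
    have lt: "\<bar>snd b' - snd b\<bar> < M" using M[OF that(1)] M[OF that(2)] by linarith
    have "fst b = fst b'"
    proof (rule ccontr)
      assume "fst b \<noteq> fst b'"
      then have "\<bar>fst b - fst b'\<bar> \<ge> 1" by linarith
      then have "M * 1 \<le> M * \<bar>fst b - fst b'\<bar>"
        using lt by (intro mult_left_mono) auto
      also have "\<dots> = \<bar>M * (fst b - fst b')\<bar>" using lt by (simp add: abs_mult)
      finally show False using eq lt by simp
    qed
    then show ?thesis using eq by (simp add: prod_eq_iff)
  qed
  have "Max (f ` B) \<in> f ` B" using assms by (intro Max_in) auto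
  then obtain b0 where b0: "b0 \<in> B" "f b0 = Max (f ` B)" by auto
  show ?thesis
  proof (rule that[OF b0(1), of f])
    show "f (x + y) = f x + f y" for x y by (simp add: f_def algebra_simps)
    show "f b < f b0" if "b \<in> B" "b \<noteq> b0" for b
    proof -
      have "f b \<le> f b0" using b0 that assms by simp
      moreover have "f b \<noteq> f b0" using inj[of b b0] that b0 by auto
      ultimately show ?thesis by simp
    qed
  qed
qed

lemma finite_translates:
  fixes R :: "'a::ab_group_add set"
  assumes "finite R" "P \<noteq> {}"
  shows "finite {v. (+) v ` P \<subseteq> R}"
proof -
  obtain a where a: "a \<in> P" using assms by auto
  have "v \<in> (\<lambda>x. x - a) ` R" if "(+) v ` P \<subseteq> R" for v
    using that a by (intro image_eqI[of _ _ "v + a"]) auto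
  then have "{v. (+) v ` P \<subseteq> R} \<subseteq> (\<lambda>x. x - a) ` R" by auto
  then show ?thesis using assms(1) finite_surj by blast
qed

definition double_translates :: "'a::ab_group_add set \<Rightarrow> 'a set \<Rightarrow> 'a set \<Rightarrow> 'a set" where
  "double_translates A B R = {w. \<forall>a\<in>A. \<forall>b\<in>B. w + a + b \<in> R}"

lemma card_Int_translate_sum:
  fixes E :: "'a::ab_group_add set"
  assumes "finite P"
  shows "card (E \<inter> (+) v ` P) = (\<Sum>a\<in>P. of_bool (v + a \<in> E))"
proof -
  have "E \<inter> (+) v ` P = (+) v ` {a\<in>P. v + a \<in> E}" by auto
  then have "card (E \<inter> (+) v ` P) = card {a\<in>P. v + a \<in> E}"
    by (simp add: card_image)
  also have "\<dots> = (\<Sum>a\<in>P. of_bool (v + a \<in> E))"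
    using assms by (simp add: Collect_conj_eq)
  finally show ?thesis .
qed

text \<open>Over the two-element field the symmetric difference is the sum, and the parity of the
  trace on \<open>W\<close> is linear.\<close>

lemma even_sym_diff:
  assumes "finite W" "even (card (Z \<inter> W)) = even (card (Z' \<inter> W))"
  shows "even (card (((Z - Z') \<union> (Z' - Z)) \<inter> W))"
proof -
  have split: "card (U \<union> V) = card U + card V" if "U \<subseteq> W" "V \<subseteq> W" "U \<inter> V = {}" for U V
    using that assms(1) by (intro card_Un_disjoint) (auto intro: finite_subset)
  have Z: "Z \<inter> W = ((Z - Z') \<inter> W) \<union> (Z \<inter> Z' \<inter> W)"
    and Z': "Z' \<inter> W = ((Z' - Z) \<inter> W) \<union> (Z \<inter> Z' \<inter> W)"
    and D: "((Z - Z') \<union> (Z' - Z)) \<inter> W = ((Z - Z') \<inter> W) \<union> ((Z' - Z) \<inter> W)"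
    by auto
  have "card (Z \<inter> W) = card ((Z - Z') \<inter> W) + card (Z \<inter> Z' \<inter> W)"
    by (subst Z, rule split) auto
  moreover have "card (Z' \<inter> W) = card ((Z' - Z) \<inter> W) + card (Z \<inter> Z' \<inter> W)"
    by (subst Z', rule split) auto
  moreover have "card (((Z - Z') \<union> (Z' - Z)) \<inter> W) = card ((Z - Z') \<inter> W) + card ((Z' - Z) \<inter> W)"
    by (subst D, rule split) auto
  ultimately show ?thesis using assms(2) by presburger
qed

text \<open>
  Over the two-element field, a subset of \<open>R\<close> is determined by its trace on the seed together with
  its parities on all translates inside \<open>R\<close>; the parities on the translates of \<open>A\<close> and of \<open>B\<close>
  satisfy one relation for each translate of \<open>A + B\<close>.
\<close>
lemma card_le_derivable:
  fixes A B R S :: "(int \<times> int) set"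
  assumes fin: "finite A" "A \<noteq> {}" "finite B" "B \<noteq> {}" "finite R"
    and der: "R \<subseteq> derivable {A, B} R S"
  shows "card R + card (double_translates A B R) \<le>
    card (S \<inter> R) + card {v. (+) v ` A \<subseteq> R} + card {v. (+) v ` B \<subseteq> R}"
proof -
  define F where "F = {v. (+) v ` A \<subseteq> R}"
  define G where "G = {v. (+) v ` B \<subseteq> R}"
  define H where "H = double_translates A B R"
  obtain b0 f where b0: "b0 \<in> B" and f: "\<And>x y. f (x + y) = f x + (f y :: int)"
    "\<And>b. b \<in> B \<Longrightarrow> b \<noteq> b0 \<Longrightarrow> f b < f b0"
    using ex_additive_strict_max[of B] fin by metis
  \<comment> \<open>One translate of \<open>A\<close> is dropped for each relation: the one at
    \<open>w + b0\<close>, where \<open>f\<close> is largest among the \<open>w + b\<close>. Its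
    parity can be recovered from the other translates of \<open>A\<close> and those of
    \<open>B\<close>.\<close>
  define T where "T = (\<lambda>w. w + b0) ` H"
  have finF: "finite F" and finG: "finite G"
    unfolding F_def G_def using fin finite_translates by blast+
  have HF: "w + b \<in> F" if "w \<in> H" "b \<in> B" for w b
    using that by (auto simp: H_def F_def double_translates_def add.assoc add.commute[of b])
  have HG: "w + a \<in> G" if "w \<in> H" "a \<in> A" for w a
    using that by (auto simp: H_def G_def double_translates_def add.assoc)
  have TF: "T \<subseteq> F" using HF[OF _ b0] unfolding T_def by blast
  have cardT: "card T = card H" unfolding T_def by (intro card_image inj_onI) simp
  \<comment> \<open>These data determine a subset of \<open>R\<close>; comparing numbers of subsets,
    all powers of two, gives the bound.\<close>
  define \<Phi> where "\<Phi> = (\<lambda>Z. (Z \<inter> (S \<inter> R), {v\<in>F - T. odd (card (Z \<inter> (+) v ` A))},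
      {v\<in>G. odd (card (Z \<inter> (+) v ` B))}))"
  have "inj_on \<Phi> (Pow R)"
  proof (rule inj_onI)
    fix Z Z' assume Z: "Z \<in> Pow R" "Z' \<in> Pow R" and eq: "\<Phi> Z = \<Phi> Z'"
    define E where "E = (Z - Z') \<union> (Z' - Z)"
    have eqs: "Z \<inter> (S \<inter> R) = Z' \<inter> (S \<inter> R)"
      "{v\<in>F - T. odd (card (Z \<inter> (+) v ` A))} = {v\<in>F - T. odd (card (Z' \<inter> (+) v ` A))}"
      "{v\<in>G. odd (card (Z \<inter> (+) v ` B))} = {v\<in>G. odd (card (Z' \<inter> (+) v ` B))}"
      using eq unfolding \<Phi>_def prod.inject by blast+
    have S: "E \<inter> S = {}" using eqs(1) Z unfolding E_def by blast
    have evenFT: "even (card (E \<inter> (+) v ` A))" if "v \<in> F - T" for v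
      unfolding E_def
    proof (rule even_sym_diff)
      show "finite ((+) v ` A)" using fin by simp
      show "even (card (Z \<inter> (+) v ` A)) = even (card (Z' \<inter> (+) v ` A))"
        using eqs(2) that by blast
    qed
    have evenG: "even (card (E \<inter> (+) v ` B))" if "v \<in> G" for v
      unfolding E_def
    proof (rule even_sym_diff)
      show "finite ((+) v ` B)" using fin by simp
      show "even (card (Z \<inter> (+) v ` B)) = even (card (Z' \<inter> (+) v ` B))"
        using eqs(3) that by blast
    qed
    \<comment> \<open>Both sums count the pairs \<open>(a, b)\<close> with \<open>w + a + b\<close>
      in \<open>E\<close>, grouped once by translates of \<open>A\<close> and once by translates of
      \<open>B\<close>.\<close>
    have relation: "even (\<Sum>b\<in>B. card (E \<inter> (+) (w + b) ` A))" if "w \<in> H" for w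
    proof -
      have "(\<Sum>b\<in>B. card (E \<inter> (+) (w + b) ` A)) = (\<Sum>b\<in>B. \<Sum>a\<in>A. of_bool (w + b + a \<in> E))"
        using fin by (simp add: card_Int_translate_sum)
      also have "\<dots> = (\<Sum>a\<in>A. \<Sum>b\<in>B. of_bool (w + a + b \<in> E))"
        by (subst sum.swap) (simp add: algebra_simps)
      also have "\<dots> = (\<Sum>a\<in>A. card (E \<inter> (+) (w + a) ` B))"
        using fin by (simp add: card_Int_translate_sum)
      moreover have "even (\<Sum>a\<in>A. card (E \<inter> (+) (w + a) ` B))"
        by (intro dvd_sum evenG HG that)
      ultimately show ?thesis by metis
    qed
    \<comment> \<open>A lower bound for \<open>f\<close> on \<open>F\<close> gives a natural number
      measure: the omitted parity at \<open>w + b0\<close> follows from those at the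
      \<open>w + b\<close> with smaller \<open>f\<close>.\<close>
    define m where "m = Min (insert 0 (f ` F))"
    have evenF: "even (card (E \<inter> (+) v ` A))" if "v \<in> F" for v
      using that
    proof (induction "nat (f v - m)" arbitrary: v rule: less_induct)
      case (less v)
      show ?case
      proof (cases "v \<in> T")
        case False
        then show ?thesis using evenFT less by blast
      next
        case True
        then obtain w where w: "w \<in> H" "v = w + b0" by (auto simp: T_def)
        have "even (card (E \<inter> (+) (w + b) ` A))" if "b \<in> B - {b0}" for b
        proof (rule less.hyps)
          have "f (w + b) < f v" using f(2)[of b] that by (simp add: w f(1))
          moreover have "m \<le> f (w + b)"
            unfolding m_def using HF[OF w(1), of b] that finF by (intro Min_le) blast+
          ultimately show "nat (f (w + b) - m) < nat (f v - m)" by simp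
          show "w + b \<in> F" using HF[OF w(1)] that by blast
        qed
        then have "even (\<Sum>b\<in>B - {b0}. card (E \<inter> (+) (w + b) ` A))" by (intro dvd_sum) auto
        moreover have "(\<Sum>b\<in>B. card (E \<inter> (+) (w + b) ` A)) = card (E \<inter> (+) (w + b0) ` A)
          + (\<Sum>b\<in>B - {b0}. card (E \<inter> (+) (w + b) ` A))"
          using fin b0 by (intro sum.remove) auto
        ultimately show ?thesis using relation[OF w(1)] w by simp
      qed
    qed
    \<comment> \<open>If a filled point \<open>p\<close> lay in \<open>E\<close>, it would be the
      only point of \<open>E\<close> in its translate, against the even count.\<close>
    have "p \<notin> E" if "p \<in> derivable {A, B} R S" for p
      using that
    proof induction
      case (seed p)
      then show ?case using S by auto
    next
      case (fill P v p)
      have "even (card (E \<inter> (+) v ` P))"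
        using fill evenF[of v] evenG[of v] by (auto simp: F_def G_def)
      moreover have "E \<inter> (+) v ` P = {p}" if "p \<in> E" using that fill.hyps(3) fill.IH by blast
      ultimately show ?case by auto
    qed
    then have "E \<inter> R = {}" using der by blast
    then show "Z = Z'" using Z by (auto simp: E_def)
  qed
  moreover have "\<Phi> ` Pow R \<subseteq> Pow (S \<inter> R) \<times> Pow (F - T) \<times> Pow G"
    by (auto simp: \<Phi>_def)
  moreover have "finite (Pow (S \<inter> R) \<times> Pow (F - T) \<times> Pow G)"
    using fin finF finG by auto
  ultimately have "card (Pow R) \<le> card (Pow (S \<inter> R) \<times> Pow (F - T) \<times> Pow G)"
    by (metis card_inj_on_le)
  also have "\<dots> = 2 ^ (card (S \<inter> R) + card (F - T) + card G)"
    using fin finF finG by (simp add: card_cartesian_product card_Pow power_add del: Pow_Int_eq)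
  finally have "card R \<le> card (S \<inter> R) + card (F - T) + card G"
    using fin by (simp add: card_Pow)
  moreover have "card (F - T) + card T = card F"
    using TF finF by (metis card_Diff_subset card_mono finite_subset le_add_diff_inverse2)
  ultimately show ?thesis using cardT by (simp add: F_def G_def H_def)
qed

subsection \<open>Lattice polygons\<close>

definition rpt :: "int \<times> int \<Rightarrow> real \<times> real" where
  "rpt x = (real_of_int (fst x), real_of_int (snd x))"

lemma lattice_hull_rpt: "lattice_hull A = convex hull (rpt ` A)"
proof -
  have "map_prod real_of_int real_of_int = rpt" by (auto simp: rpt_def fun_eq_iff)
  then show ?thesis by (simp add: lattice_hull_def)
qed

lemma rpt_add: "rpt (x + y) = rpt x + rpt y" and rpt_diff: "rpt (x - y) = rpt x - rpt y"
  by (simp_all add: rpt_def)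

lemma rpt_inject: "rpt x = rpt y \<longleftrightarrow> x = y"
  by (simp add: rpt_def prod_eq_iff)

definition support_value :: "real \<times> real \<Rightarrow> (int \<times> int) set \<Rightarrow> real" where
  "support_value u P = Max ((\<lambda>a. u \<bullet> rpt a) ` P)"

text \<open>For finite nonempty \<open>P\<close>, stability of a nonzero direction is tested below
  as the failure of this set to be a singleton.\<close>

definition top_face :: "real \<times> real \<Rightarrow> (int \<times> int) set \<Rightarrow> (int \<times> int) set" where
  "top_face u P = {a \<in> P. u \<bullet> rpt a = support_value u P}"

lemma support_value_ge:
  assumes "finite P" "a \<in> P"
  shows "u \<bullet> rpt a \<le> support_value u P"
  using assms by (simp add: support_value_def)

lemma top_face_nonempty:
  assumes "finite P" "P \<noteq> {}"
  shows "top_face u P \<noteq> {}"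
proof -
  have "support_value u P \<in> (\<lambda>a. u \<bullet> rpt a) ` P"
    unfolding support_value_def using assms by (intro Max_in) auto
  then obtain a where "support_value u P = u \<bullet> rpt a" "a \<in> P" by (rule imageE)
  then have "a \<in> top_face u P" by (simp add: top_face_def)
  then show ?thesis by blast
qed

lemma top_face_strict:
  assumes "finite P" "top_face u P = {a}" "x \<in> P" "x \<noteq> a"
  shows "u \<bullet> rpt x < u \<bullet> rpt a"
proof -
  have "u \<bullet> rpt a = support_value u P" "u \<bullet> rpt x \<noteq> support_value u P"
    using assms by (auto simp: top_face_def)
  then show ?thesis using support_value_ge[OF assms(1,3), of u] by linarith
qed

lemma top_face_scaleR:
  assumes "0 < k" "finite P" "P \<noteq> {}"
  shows "top_face (k *\<^sub>R u) P = top_face u P" "support_value (k *\<^sub>R u) P = k * support_value u P"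
proof -
  obtain a where "a \<in> top_face (k *\<^sub>R u) P" using top_face_nonempty assms by blast
  then have a: "a \<in> P" "k * (u \<bullet> rpt a) = support_value (k *\<^sub>R u) P" by (auto simp: top_face_def)
  obtain b where "b \<in> top_face u P" using top_face_nonempty assms by blast
  then have b: "b \<in> P" "u \<bullet> rpt b = support_value u P" by (auto simp: top_face_def)
  have "u \<bullet> rpt a \<le> u \<bullet> rpt b" using support_value_ge[OF assms(2) a(1), of u] b by simp
  moreover have "k * (u \<bullet> rpt b) \<le> k * (u \<bullet> rpt a)"
    using support_value_ge[OF assms(2) b(1), of "k *\<^sub>R u"] a by simp
  ultimately show "support_value (k *\<^sub>R u) P = k * support_value u P"
    using a b assms(1) by (metis mult_le_cancel_left_pos order_antisym)
  then show "top_face (k *\<^sub>R u) P = top_face u P" using assms(1) by (simp add: top_face_def)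
qed

lemma rpt_in_lattice_hull: "a \<in> P \<Longrightarrow> rpt a \<in> lattice_hull P"
  unfolding lattice_hull_rpt by (intro hull_inc) auto

lemma convex_lattice_hull: "convex (lattice_hull P)"
  by (simp add: lattice_hull_rpt)

lemma compact_lattice_hull: "finite P \<Longrightarrow> compact (lattice_hull P)"
  by (simp add: lattice_hull_rpt finite_imp_compact_convex_hull)

lemma lattice_hull_le_support:
  assumes "finite P" "\<xi> \<in> lattice_hull P"
  shows "u \<bullet> \<xi> \<le> support_value u P"
proof -
  have "lattice_hull P \<subseteq> {x. u \<bullet> x \<le> support_value u P}"
    unfolding lattice_hull_rpt
    by (intro hull_minimal convex_halfspace_le image_subsetI CollectI support_value_ge[OF assms(1)])
  then show ?thesis using assms by auto
qed

text \<open>A supporting line cuts out a face, and a face of the hull of a finite set is spanned by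
  the points of the set lying in it.\<close>

lemma lattice_hull_top_face:
  assumes "finite P" "\<xi> \<in> lattice_hull P" "u \<bullet> \<xi> = support_value u P"
  shows "\<xi> \<in> lattice_hull (top_face u P)"
proof -
  define T where "T = lattice_hull P \<inter> {x. u \<bullet> x = support_value u P}"
  have "T face_of convex hull (rpt ` P)"
    unfolding T_def lattice_hull_rpt
    by (intro face_of_Int_supporting_hyperplane_le convex_convex_hull)
      (use lattice_hull_le_support[OF assms(1)] in \<open>simp add: lattice_hull_rpt\<close>)
  then obtain S' where S': "S' \<subseteq> rpt ` P" "T = convex hull S'"
    using assms(1) face_of_convex_hull_subset[of "rpt ` P" T] by (metis finite_imageI finite_imp_compact)
  have "S' \<subseteq> T" using S' hull_subset[of S' convex] by simp
  have "S' \<subseteq> rpt ` top_face u P"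
  proof
    fix z assume z: "z \<in> S'"
    then obtain a where a: "a \<in> P" "z = rpt a" using S'(1) by blast
    then have "a \<in> top_face u P"
      using z \<open>S' \<subseteq> T\<close> unfolding T_def top_face_def by blast
    then show "z \<in> rpt ` top_face u P" using a by blast
  qed
  then have "T \<subseteq> lattice_hull (top_face u P)"
    unfolding S' lattice_hull_rpt by (rule hull_mono)
  then show ?thesis using assms by (auto simp: T_def)
qed

lemma lattice_hull_singleton: "lattice_hull {a} = {rpt a}"
  by (simp add: lattice_hull_rpt)

section \<open>Stable directions and the case of a shared one\<close>

text \<open>With one topmost point the face in direction \<open>u\<close> is a point, which contains
  no edge. With two topmost points it contains a segment and lies in a line, so its dimension is
  1.\<close>

lemma outward_unit_normal_iff:
  assumes "finite P" "P \<noteq> {}"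
  shows "outward_unit_normal u (lattice_hull P) \<longleftrightarrow> norm u = 1 \<and> (\<nexists>a. top_face u P = {a})"
proof (intro iffI conjI notI; (elim conjE exE)?)
  assume "outward_unit_normal u (lattice_hull P)"
  then show "norm u = 1" by (simp add: outward_unit_normal_def)
next
  fix a assume "outward_unit_normal u (lattice_hull P)" and a: "top_face u P = {a}"
  then obtain E c where E: "E edge_of lattice_hull P"
    and c: "\<forall>x\<in>E. u \<bullet> x = c" "\<forall>x\<in>lattice_hull P. u \<bullet> x \<le> c"
    by (auto simp: outward_unit_normal_def)
  have aP: "a \<in> P" "u \<bullet> rpt a = support_value u P" using a by (auto simp: top_face_def)
  have sub: "E \<subseteq> lattice_hull P" using E face_of_imp_subset by (auto simp: edge_of_def)
  have "E \<subseteq> {rpt a}"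
  proof
    fix x assume x: "x \<in> E"
    have "support_value u P \<le> u \<bullet> x" using x c rpt_in_lattice_hull[OF aP(1)] aP(2) by metis
    then have "u \<bullet> x = support_value u P"
      using lattice_hull_le_support[OF assms(1), of x u] x sub by force
    then show "x \<in> {rpt a}"
      using lattice_hull_top_face[OF assms(1), of x u] x sub a lattice_hull_singleton by (metis subsetD)
  qed
  then have "aff_dim E \<le> aff_dim {rpt a}" by (rule aff_dim_subset)
  then show False using E by (simp add: edge_of_def)
next
  assume u: "norm u = 1" and na: "\<nexists>a. top_face u P = {a}"
  obtain a where a: "a \<in> top_face u P" using top_face_nonempty[OF assms] by blast
  obtain a' where a': "a' \<in> top_face u P" "a' \<noteq> a" using a na by blast
  define E where "E = lattice_hull P \<inter> {x. u \<bullet> x = support_value u P}"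
  have face: "E face_of lattice_hull P"
    unfolding E_def
    by (intro face_of_Int_supporting_hyperplane_le convex_lattice_hull)
      (use lattice_hull_le_support[OF assms(1)] in auto)
  have "{rpt a, rpt a'} \<subseteq> E"
    using a a' by (auto simp: E_def top_face_def rpt_in_lattice_hull)
  then have "aff_dim {rpt a, rpt a'} \<le> aff_dim E" by (rule aff_dim_subset)
  moreover have "aff_dim {rpt a, rpt a'} = 1" using a' by (simp add: aff_dim_2 rpt_inject)
  moreover have "aff_dim E \<le> aff_dim {x. u \<bullet> x = support_value u P}"
    by (rule aff_dim_subset) (auto simp: E_def)
  moreover have "u \<noteq> 0" using u by auto
  then have "aff_dim {x. u \<bullet> x = support_value u P} = 1" by (simp add: aff_dim_hyperplane)
  ultimately have "E edge_of lattice_hull P" using face by (simp add: edge_of_def)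
  then show "outward_unit_normal u (lattice_hull P)"
    unfolding outward_unit_normal_def using u lattice_hull_le_support[OF assms(1)]
    by (intro conjI exI[of _ E] exI[of _ "support_value u P"]) (auto simp: E_def)
qed

text \<open>A half-plane with outward normal \<open>u\<close> that contains the seed is closed under
  filling, because every point of a pattern is matched by a different point of that pattern at least
  as high.\<close>

lemma no_finite_seed:
  fixes \<A> :: "(int \<times> int) set set"
  assumes \<A>: "\<And>P. P \<in> \<A> \<Longrightarrow> finite P" "\<And>P a. P \<in> \<A> \<Longrightarrow> top_face u P \<noteq> {a}"
    and u: "u \<noteq> 0" and S: "finite S"
  shows "\<not> percolates \<A> S"
proof
  assume perc: "percolates \<A> S"
  define M where "M = Max (insert 0 ((\<lambda>x. u \<bullet> rpt x) ` S))"
  have "u \<bullet> rpt p \<le> M" if "p \<in> derivable \<A> UNIV S" for p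
    using that
  proof induction
    case (seed p)
    then show ?case using S by (auto simp: M_def)
  next
    case (fill P v p)
    then obtain a where a: "a \<in> P" "p = v + a" by blast
    have "P \<noteq> {}" using a by auto
    then obtain a' where a': "a' \<in> top_face u P" "a' \<noteq> a"
      using top_face_nonempty[of P u] \<A>[OF fill(1)] by blast
    have "u \<bullet> rpt a \<le> u \<bullet> rpt a'"
      using a a' support_value_ge[OF \<A>(1)[OF fill(1)], of a u] by (auto simp: top_face_def)
    moreover have "u \<bullet> rpt (v + a') \<le> M"
      using a' a by (intro fill.IH) (auto simp: top_face_def)
    ultimately show ?case by (simp add: a rpt_add inner_add_right)
  qed
  then have M: "u \<bullet> rpt p \<le> M" for p using percolates_imp_derivable[OF perc] by blast
  have "fst u \<noteq> 0 \<or> snd u \<noteq> 0" using u by (simp add: prod_eq_iff)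
  then have "\<bar>fst u\<bar> + \<bar>snd u\<bar> > 0" by linarith
  then obtain n :: nat where "M < real n * (\<bar>fst u\<bar> + \<bar>snd u\<bar>)"
    using reals_Archimedean3 by blast
  also have "\<dots> = u \<bullet> rpt (int n * (if fst u \<ge> 0 then 1 else -1), int n * (if snd u \<ge> 0 then 1 else -1))"
    by (simp add: rpt_def inner_prod_def algebra_simps)
  also have "\<dots> \<le> M" by (rule M)
  finally show False by simp
qed

lemma finite_bounded_lattice: "finite {x. norm (rpt x - c) \<le> M}"
proof -
  define K where "K = \<lceil>M + norm c\<rceil>"
  have "{x. norm (rpt x - c) \<le> M} \<subseteq> {-K..K} \<times> {-K..K}"
  proof
    fix x assume "x \<in> {x. norm (rpt x - c) \<le> M}"
    then have "norm (rpt x) \<le> M + norm c" using norm_triangle_ineq2[of "rpt x" c] by simp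
    moreover have "norm (real_of_int (fst x)) \<le> norm (rpt x)" "norm (real_of_int (snd x)) \<le> norm (rpt x)"
      unfolding rpt_def by (rule norm_fst_le, rule norm_snd_le)
    ultimately have "\<bar>real_of_int (fst x)\<bar> \<le> M + norm c" "\<bar>real_of_int (snd x)\<bar> \<le> M + norm c"
      by simp_all
    then have "\<bar>fst x\<bar> \<le> K" "\<bar>snd x\<bar> \<le> K" unfolding K_def by linarith+
    then show "x \<in> {-K..K} \<times> {-K..K}" by (simp add: mem_Times_iff abs_le_iff)
  qed
  then show ?thesis by (rule finite_subset) simp
qed

subsection \<open>Homothetic growth from a generic centre\<close>

text \<open>Quarter turn; \<open>rot u \<bullet> x\<close> is the determinant of \<open>u\<close>
  and \<open>x\<close>, so it vanishes exactly when they are parallel.\<close>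

definition rot :: "real \<times> real \<Rightarrow> real \<times> real" where
  "rot u = (- snd u, fst u)"

text \<open>\<open>u\<close> and \<open>rot u\<close> form an orthogonal basis of the plane.\<close>

lemma plane_vector_eqI:
  assumes "u \<noteq> 0" "u \<bullet> x = u \<bullet> y" "rot u \<bullet> x = rot u \<bullet> y"
  shows "x = y"
proof -
  obtain u1 u2 where u: "u = (u1, u2)" by (cases u)
  define z1 where "z1 = fst x - fst y"
  define z2 where "z2 = snd x - snd y"
  have 1: "u1 * z1 + u2 * z2 = 0" and 2: "u1 * z2 - u2 * z1 = 0"
    using assms(2,3) by (simp_all add: u rot_def inner_prod_def z1_def z2_def algebra_simps)
  have "(u1\<^sup>2 + u2\<^sup>2) * z1 = u1 * (u1 * z1 + u2 * z2) - u2 * (u1 * z2 - u2 * z1)"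
    "(u1\<^sup>2 + u2\<^sup>2) * z2 = u2 * (u1 * z1 + u2 * z2) + u1 * (u1 * z2 - u2 * z1)"
    by (simp_all add: power2_eq_square algebra_simps)
  moreover have "u1\<^sup>2 + u2\<^sup>2 \<noteq> 0" using assms(1) by (auto simp: u zero_prod_def)
  ultimately have "z1 = 0" "z2 = 0" unfolding 1 2 by auto
  then show ?thesis by (simp add: z1_def z2_def prod_eq_iff)
qed

lemma inner_rot_self: "u \<bullet> rot u = 0"
  by (simp add: rot_def inner_prod_def)

lemma rot_eq_0_iff: "rot u = 0 \<longleftrightarrow> u = 0"
  by (auto simp: rot_def prod_eq_iff)

lemma orthogonal_eq_scaleR_rot:
  assumes "d \<noteq> 0" "u \<bullet> d = 0"
  obtains k where "u = k *\<^sub>R rot d"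
proof
  let ?k = "(rot d \<bullet> u) / (d \<bullet> d)"
  have dd: "d \<bullet> d \<noteq> 0" using assms(1) by simp
  have "rot d \<bullet> rot d = d \<bullet> d" by (simp add: rot_def inner_prod_def)
  then show "u = ?k *\<^sub>R rot d"
    using assms dd by (intro plane_vector_eqI[OF assms(1)]) (simp_all add: inner_rot_self inner_commute)
qed

text \<open>Normals of all chords between points of \<open>P\<close>, in both senses since the pairs
  are ordered. Up to positive scaling this finite set contains every stable direction of
  \<open>P\<close>.\<close>

definition normals :: "(int \<times> int) set \<Rightarrow> (real \<times> real) set" where
  "normals P = (\<lambda>(a, a'). rot (rpt a - rpt a')) ` {(a, a'). a \<in> P \<and> a' \<in> P \<and> a \<noteq> a'}"

lemma finite_normals: "finite P \<Longrightarrow> finite (normals P)"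
  unfolding normals_def
  by (intro finite_imageI) (rule finite_subset[of _ "P \<times> P"], auto)

lemma normals_nonzero: "u \<in> normals P \<Longrightarrow> u \<noteq> 0"
  by (auto simp: normals_def rot_eq_0_iff rpt_inject)

lemma two_top_points_normal:
  assumes "a \<in> top_face u P" "a' \<in> top_face u P" "a \<noteq> a'" "u \<noteq> 0"
  obtains n k where "n \<in> normals P" "0 < k" "u = k *\<^sub>R n"
proof -
  have aP: "a \<in> P" "a' \<in> P" using assms by (simp_all add: top_face_def)
  have "u \<bullet> (rpt a - rpt a') = 0" using assms by (simp add: top_face_def inner_diff_right)
  moreover have "rpt a - rpt a' \<noteq> 0" using assms by (simp add: rpt_inject)
  ultimately obtain k where k: "u = k *\<^sub>R rot (rpt a - rpt a')"
    by (metis orthogonal_eq_scaleR_rot)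
  have in_normals: "rot (rpt x - rpt y) \<in> normals P" if "x \<in> P" "y \<in> P" "x \<noteq> y" for x y
    unfolding normals_def using that by (intro image_eqI[of _ _ "(x, y)"]) auto
  show ?thesis
  proof (cases "k > 0")
    case True
    then show ?thesis using that[of "rot (rpt a - rpt a')" k] k in_normals aP assms by simp
  next
    case False
    moreover have "k \<noteq> 0" using k assms by auto
    moreover have "u = (- k) *\<^sub>R rot (rpt a' - rpt a)" using k by (simp add: rot_def prod_eq_iff algebra_simps)
    ultimately show ?thesis using that[of "rot (rpt a' - rpt a)" "- k"] in_normals aP assms by simp
  qed
qed

text \<open>The support function of \<open>conv A + conv B - q\<close>.\<close>
definition clearance :: "(int \<times> int) set \<Rightarrow> (int \<times> int) set \<Rightarrow> real \<times> real \<Rightarrow> real \<times> real \<Rightarrow> real" where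
  "clearance A B q u = support_value u A + support_value u B - u \<bullet> q"

text \<open>
  Around the centre \<open>s + q\<close>, no lattice point lies in the direction of a vertex of \<open>conv A + conv B\<close>,
  lattice points on different sides of the growing polygon are never reached at the same time, and
  no lattice point lies on the boundary of the polygon at time 1.
\<close>
definition generic_shift ::
    "(int \<times> int) set \<Rightarrow> (int \<times> int) set \<Rightarrow> real \<times> real \<Rightarrow> real \<times> real \<Rightarrow> bool" where
  "generic_shift A B q s \<longleftrightarrow>
    (\<forall>a\<in>A. \<forall>b\<in>B. \<forall>x. rpt a + rpt b \<noteq> q \<longrightarrow> rot (rpt a + rpt b - q) \<bullet> (rpt x - (s + q)) \<noteq> 0) \<and>
    (\<forall>u\<in>normals A \<union> normals B. \<forall>u'\<in>normals A \<union> normals B. \<forall>x x'.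
      clearance A B q u' *\<^sub>R u \<noteq> clearance A B q u *\<^sub>R u' \<longrightarrow>
      clearance A B q u' * (u \<bullet> (rpt x - (s + q))) \<noteq> clearance A B q u * (u' \<bullet> (rpt x' - (s + q)))) \<and>
    (\<forall>u\<in>normals A \<union> normals B. \<forall>x. u \<bullet> (rpt x - (s + q)) \<noteq> clearance A B q u)"

locale generic_pair =
  fixes A B :: "(int \<times> int) set" and q s :: "real \<times> real"
  assumes fin: "finite A" "finite B" and ne: "A \<noteq> {}" "B \<noteq> {}"
    and no_shared: "\<And>u. u \<noteq> 0 \<Longrightarrow> (\<exists>a. top_face u A = {a}) \<or> (\<exists>b. top_face u B = {b})"
    and q: "q \<in> interior (lattice_hull A + lattice_hull B)"
    and generic: "generic_shift A B q s"
begin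

definition "c = s + q"
definition "X = lattice_hull A + lattice_hull B"
abbreviation "Y \<equiv> clearance A B q"

text \<open>Lets each argument about a pattern and its partner serve both assignments of
  \<open>A\<close> and \<open>B\<close>.\<close>

definition pair :: "(int \<times> int) set \<Rightarrow> (int \<times> int) set \<Rightarrow> bool" where
  "pair P Q \<longleftrightarrow> P = A \<and> Q = B \<or> P = B \<and> Q = A"

lemma pairD:
  assumes "pair P Q"
  shows "finite P" "finite Q" "P \<noteq> {}" "Q \<noteq> {}" "X = lattice_hull P + lattice_hull Q"
    "Y u = support_value u P + support_value u Q - u \<bullet> q" "P \<in> {A, B}" "Q \<in> {A, B}" "pair Q P"
  using assms fin ne by (auto simp: pair_def X_def clearance_def add.commute)

lemma pair_A_B: "pair A B" and pair_B_A: "pair B A"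
  by (simp_all add: pair_def)

lemma compact_X: "compact X"
proof -
  have "X = {x + y | x y. x \<in> lattice_hull A \<and> y \<in> lattice_hull B}"
    unfolding X_def set_plus_def by blast
  then show ?thesis using compact_sums[OF compact_lattice_hull compact_lattice_hull] fin by simp
qed

lemma convex_X: "convex X"
  by (simp add: X_def convex_set_plus convex_lattice_hull)

lemma q_interior: "q \<in> interior X"
  using q by (simp add: X_def)

lemma X_le_clearance:
  assumes "\<xi> \<in> X"
  shows "u \<bullet> (\<xi> - q) \<le> Y u"
proof -
  obtain e f where "\<xi> = e + f" "e \<in> lattice_hull A" "f \<in> lattice_hull B"
    using assms by (auto simp: X_def set_plus_def)
  then show ?thesis
    using lattice_hull_le_support[of A e u] lattice_hull_le_support[of B f u] fin
    by (simp add: clearance_def inner_add_right inner_diff_right)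
qed

text \<open>Each summand is bounded by its support value, so attaining the sum of the two bounds
  forces equality in both.\<close>

lemma top_decomposition:
  assumes "pair P Q" "\<xi> \<in> X" "u \<bullet> (\<xi> - q) = Y u"
  obtains e f where "\<xi> = e + f" "e \<in> lattice_hull (top_face u P)" "f \<in> lattice_hull (top_face u Q)"
proof -
  obtain e f where ef: "\<xi> = e + f" "e \<in> lattice_hull P" "f \<in> lattice_hull Q"
    using assms pairD(5)[OF assms(1)] by (auto simp: set_plus_def)
  have "u \<bullet> e \<le> support_value u P" "u \<bullet> f \<le> support_value u Q"
    using lattice_hull_le_support pairD[OF assms(1)] ef by auto
  moreover have "u \<bullet> e + u \<bullet> f = support_value u P + support_value u Q"
    using assms(3) pairD(6)[OF assms(1), of u] by (simp add: ef inner_add_right inner_diff_right)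
  ultimately show ?thesis
    using that ef lattice_hull_top_face pairD[OF assms(1)] by simp
qed

lemma clearance_pos:
  assumes "u \<noteq> 0"
  shows "0 < Y u"
proof -
  obtain e where e: "e > 0" "cball q e \<subseteq> X"
    using q_interior mem_interior_cball by blast
  have "q + (e / norm u) *\<^sub>R u \<in> cball q e"
    using e assms by (simp add: dist_norm)
  then have "u \<bullet> ((e / norm u) *\<^sub>R u) \<le> Y u" using X_le_clearance[of "q + (e / norm u) *\<^sub>R u" u] e by auto
  moreover have "u \<bullet> ((e / norm u) *\<^sub>R u) > 0" using e assms by simp
  ultimately show ?thesis by linarith
qed

section \<open>The gauge function of the shifted polygon\<close>

lemma lattice_ne_center: "rpt x \<noteq> c"
proof
  assume x: "rpt x = c"
  \<comment> \<open>Any nonzero direction yields topmost points whose sum differs from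
    \<open>q\<close>; the first genericity condition at that sum excludes a lattice point at the
    centre.\<close>
  define u where "u = (1::real, 0::real)"
  have u: "u \<noteq> 0" by (simp add: u_def zero_prod_def)
  obtain a b where a: "a \<in> top_face u A" and b: "b \<in> top_face u B"
    using top_face_nonempty fin ne by (metis all_not_in_conv)
  then have "u \<bullet> (rpt a + rpt b) > u \<bullet> q"
    using clearance_pos[OF u] by (simp add: clearance_def top_face_def inner_add_right)
  then have "rpt a + rpt b \<noteq> q" by auto
  then have "rot (rpt a + rpt b - q) \<bullet> (rpt x - (s + q)) \<noteq> 0"
    using generic a b unfolding generic_shift_def top_face_def by blast
  then show False using x by (simp add: c_def)
qed

text \<open>The value at \<open>x\<close> of the gauge function of \<open>X\<close> with respect to \<open>q\<close>, moved by the shift \<open>s\<close>.\<close>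
definition height :: "int \<times> int \<Rightarrow> real" where
  "height x = (SOME t. 0 < t \<and> q + (1 / t) *\<^sub>R (rpt x - c) \<in> frontier X)"

text \<open>The frontier point of \<open>X\<close> on the ray from \<open>q\<close> in the direction
  in which \<open>x\<close> is seen from \<open>c\<close>.\<close>

definition radial :: "int \<times> int \<Rightarrow> real \<times> real" where
  "radial x = q + (1 / height x) *\<^sub>R (rpt x - c)"

lemma height_pos: "0 < height x" and radial_frontier: "radial x \<in> frontier X"
proof -
  have "rpt x - c \<noteq> 0" using lattice_ne_center by simp
  then obtain d where d: "0 < d" "q + d *\<^sub>R (rpt x - c) \<in> frontier X"
    using ray_to_frontier[OF compact_imp_bounded[OF compact_X] q_interior] by metis
  have "\<exists>t. 0 < t \<and> q + (1 / t) *\<^sub>R (rpt x - c) \<in> frontier X"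
    using d by (intro exI[of _ "1 / d"]) simp
  then have "0 < height x \<and> q + (1 / height x) *\<^sub>R (rpt x - c) \<in> frontier X"
    unfolding height_def by (rule someI_ex)
  then show "0 < height x" "radial x \<in> frontier X" by (simp_all add: radial_def)
qed

lemma radial_in_X: "radial x \<in> X"
  using radial_frontier compact_imp_closed[OF compact_X] frontier_subset_closed by blast

lemma rpt_radial: "rpt x - c = height x *\<^sub>R (radial x - q)"
  using height_pos[of x] by (simp add: radial_def)

lemma inner_le_height: "u \<bullet> (rpt x - c) \<le> height x * Y u"
  using X_le_clearance[OF radial_in_X[of x], of u] height_pos[of x] by (simp add: rpt_radial)

text \<open>A supporting line of \<open>X\<close> at \<open>radial x\<close>. The normal
  \<open>w\<close> obtained first minimises over \<open>X\<close>, hence the change of sign.\<close>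

lemma height_supporting:
  obtains u where "u \<noteq> 0" "u \<bullet> (radial x - q) = Y u"
proof -
  have "radial x \<notin> rel_interior X"
    using radial_frontier[of x] q_interior rel_interior_nonempty_interior[of X]
    by (auto simp: frontier_def)
  then obtain w where w: "w \<noteq> 0" "\<And>y. y \<in> X \<Longrightarrow> w \<bullet> radial x \<le> w \<bullet> y"
    using supporting_hyperplane_rel_boundary[OF convex_X radial_in_X] by metis
  obtain a b where a: "a \<in> top_face (- w) A" and b: "b \<in> top_face (- w) B"
    using top_face_nonempty fin ne by (metis all_not_in_conv)
  have "rpt a + rpt b \<in> X"
    unfolding X_def using a b by (auto simp: top_face_def intro!: rpt_in_lattice_hull)
  then have "w \<bullet> radial x \<le> w \<bullet> (rpt a + rpt b)" by (rule w(2))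
  then have "Y (- w) \<le> (- w) \<bullet> (radial x - q)"
    using a b by (simp add: clearance_def top_face_def inner_add_right inner_diff_right)
  then show ?thesis
    using that[of "- w"] w(1) X_le_clearance[OF radial_in_X[of x], of "- w"] by simp
qed

text \<open>In a direction \<open>u\<close> supporting \<open>X\<close> at \<open>radial x\<close>,
  the assumption gives \<open>height x * Y u \<le> t * Y u\<close>, and \<open>Y u\<close> is
  positive.\<close>

lemma height_le:
  assumes "0 < t" "q + (1 / t) *\<^sub>R (rpt x - c) \<in> X"
  shows "height x \<le> t"
proof -
  obtain u where u: "u \<noteq> 0" "u \<bullet> (radial x - q) = Y u" by (rule height_supporting)
  have "u \<bullet> (rpt x - c) = height x * Y u" by (simp add: rpt_radial u)
  moreover have "(1 / t) * (u \<bullet> (rpt x - c)) \<le> Y u" using X_le_clearance[OF assms(2), of u] by simp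
  ultimately have "height x * Y u \<le> t * Y u" using assms(1) by (simp add: field_simps)
  then show ?thesis using clearance_pos[OF u(1)] by simp
qed

section \<open>Sides of the growing polygon\<close>

text \<open>Up to positive scaling these are the outward normals of the sides of the Minkowski
  sum.\<close>

definition stable_normals :: "(real \<times> real) set" where
  "stable_normals = {u \<in> normals A \<union> normals B. \<not> ((\<exists>a. top_face u A = {a}) \<and> (\<exists>b. top_face u B = {b}))}"

lemma stable_normals_nonzero: "u \<in> stable_normals \<Longrightarrow> u \<noteq> 0"
  unfolding stable_normals_def using normals_nonzero by blast

text \<open>If both top faces in a supporting direction were single points, \<open>radial x\<close>
  would be a sum \<open>a + b\<close>, which the first genericity condition forbids. Otherwise two
  topmost points make the direction a positive multiple of a chord normal.\<close>

lemma ex_stable_normal: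
  obtains u where "u \<in> stable_normals" "u \<bullet> (rpt x - c) = height x * Y u"
proof -
  obtain u where u: "u \<noteq> 0" "u \<bullet> (radial x - q) = Y u" by (rule height_supporting)
  have flat: "\<not> ((\<exists>a. top_face u A = {a}) \<and> (\<exists>b. top_face u B = {b}))"
  proof
    assume "(\<exists>a. top_face u A = {a}) \<and> (\<exists>b. top_face u B = {b})"
    then obtain a b where a: "top_face u A = {a}" and b: "top_face u B = {b}" by blast
    obtain e f where ef: "radial x = e + f" "e \<in> lattice_hull {a}" "f \<in> lattice_hull {b}"
      using top_decomposition[OF pair_A_B radial_in_X u(2)] a b by metis
    then have r: "radial x = rpt a + rpt b" by (simp add: lattice_hull_singleton)
    have "rpt a + rpt b \<noteq> q" using u clearance_pos[OF u(1)] by (auto simp: r)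
    moreover have "a \<in> A" "b \<in> B" using a b by (auto simp: top_face_def)
    ultimately have "rot (rpt a + rpt b - q) \<bullet> (rpt x - (s + q)) \<noteq> 0"
      using generic unfolding generic_shift_def by blast
    then show False
      using rpt_radial[of x] by (simp add: r c_def inner_rot_self inner_commute)
  qed
  then obtain P where P: "P \<in> {A, B}" "\<nexists>a. top_face u P = {a}" by blast
  then have "top_face u P \<noteq> {}" using top_face_nonempty fin ne by blast
  then obtain a a' where "a \<in> top_face u P" "a' \<in> top_face u P" "a \<noteq> a'"
    using P(2) by blast
  then obtain n k where n: "n \<in> normals P" "0 < k" "u = k *\<^sub>R n"
    using two_top_points_normal u(1) by metis
  have "n \<in> stable_normals"
    using n P(1) flat top_face_scaleR[OF n(2)] fin ne unfolding stable_normals_def by auto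
  moreover have "Y u = k * Y n"
    using top_face_scaleR[OF n(2)] fin ne by (simp add: clearance_def n algebra_simps)
  then have "n \<bullet> (rpt x - c) = height x * Y n"
    using u n by (simp add: rpt_radial)
  ultimately show ?thesis using that by blast
qed

definition level_normal :: "real \<Rightarrow> real \<times> real" where
  "level_normal t = (SOME u. u \<in> stable_normals \<and> (\<forall>x. height x = t \<longrightarrow> u \<bullet> (rpt x - c) = t * Y u))"

text \<open>Two points of equal height supported by normals \<open>u\<close> and \<open>u'\<close>
  contradict the second genericity condition unless the normals are positive multiples of each
  other, so all points of one height lie on one side.\<close>

lemma level_normal:
  assumes "height y = t"
  shows "level_normal t \<in> stable_normals"
    "\<And>x. height x = t \<Longrightarrow> level_normal t \<bullet> (rpt x - c) = t * Y (level_normal t)"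
proof -
  obtain u where u: "u \<in> stable_normals" "u \<bullet> (rpt y - c) = height y * Y u" by (rule ex_stable_normal)
  have "u \<bullet> (rpt x - c) = t * Y u" if x: "height x = t" for x
  proof -
    obtain u' where u': "u' \<in> stable_normals" "u' \<bullet> (rpt x - c) = height x * Y u'"
      by (rule ex_stable_normal)
    have "Y u' * (u \<bullet> (rpt y - (s + q))) = Y u * (u' \<bullet> (rpt x - (s + q)))"
      using u(2) u'(2) x assms by (simp add: c_def)
    then have eq: "Y u' *\<^sub>R u = Y u *\<^sub>R u'"
      using generic u(1) u'(1) unfolding generic_shift_def stable_normals_def by blast
    have "Y u' * (u \<bullet> (rpt x - c)) = (Y u' *\<^sub>R u) \<bullet> (rpt x - c)" by simp
    also have "\<dots> = Y u' * (t * Y u)" unfolding eq using u'(2) x by simp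
    finally show ?thesis using clearance_pos[OF stable_normals_nonzero[OF u'(1)]] by simp
  qed
  then have "\<exists>u. u \<in> stable_normals \<and> (\<forall>x. height x = t \<longrightarrow> u \<bullet> (rpt x - c) = t * Y u)"
    using u by blast
  then have "level_normal t \<in> stable_normals \<and>
      (\<forall>x. height x = t \<longrightarrow> level_normal t \<bullet> (rpt x - c) = t * Y (level_normal t))"
    unfolding level_normal_def by (rule someI_ex)
  then show "level_normal t \<in> stable_normals"
    "\<And>x. height x = t \<Longrightarrow> level_normal t \<bullet> (rpt x - c) = t * Y (level_normal t)" by blast+
qed

lemma height_ne_1: "height x \<noteq> 1"
proof
  assume "height x = 1"
  then have "level_normal 1 \<in> stable_normals" "level_normal 1 \<bullet> (rpt x - (s + q)) = Y (level_normal 1)"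
    using level_normal[of x 1] by (simp_all add: c_def)
  then show False using generic unfolding generic_shift_def stable_normals_def by blast
qed

lemma height_le_1_iff: "height x \<le> 1 \<longleftrightarrow> rpt x - s \<in> X"
proof
  assume le: "height x \<le> 1"
  have "rpt x - s = (1 - height x) *\<^sub>R q + height x *\<^sub>R radial x"
    using rpt_radial[of x] by (simp add: c_def algebra_simps)
  moreover have "q \<in> X" using q_interior interior_subset by blast
  ultimately show "rpt x - s \<in> X"
    using convexD[OF convex_X, of q "radial x" "1 - height x" "height x"] radial_in_X height_pos[of x] le
    by simp
next
  assume "rpt x - s \<in> X"
  then show "height x \<le> 1" using height_le[of 1 x] by (simp add: c_def algebra_simps)
qed

section \<open>Points supplied by a translate\<close>

text \<open>A stable normal has a top face with several points in one of the patterns, and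
  \<open>no_shared\<close> forbids this in both.\<close>

lemma sharp_of_level:
  assumes "u \<in> stable_normals"
  shows "(\<exists>a. top_face u A = {a}) \<longleftrightarrow> (\<nexists>b. top_face u B = {b})"
  using assms no_shared[OF stable_normals_nonzero[OF assms]] by (auto simp: stable_normals_def)

lemma pair_sharp:
  assumes "u \<in> stable_normals" "pair P Q"
  shows "(\<exists>a. top_face u P = {a}) \<longleftrightarrow> (\<nexists>b. top_face u Q = {b})"
  using sharp_of_level[OF assms(1)] assms(2) unfolding pair_def by blast

text \<open>Points of height \<open>t\<close> have the same inner product with the normal of the
  level, while \<open>x\<close> is strictly lower than the topmost point \<open>a\<close>.\<close>

lemma sharp_below:
  assumes "pair P Q" "t = height p" "top_face (level_normal t) P = {a}"
    and "x \<in> P" "x \<noteq> a" "height (p - a + x) \<le> t"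
  shows "height (p - a + x) < t"
proof (rule ccontr)
  define u where "u = level_normal t"
  assume "\<not> height (p - a + x) < t"
  then have "height (p - a + x) = t" using assms by simp
  then have "u \<bullet> (rpt (p - a + x) - c) = u \<bullet> (rpt p - c)"
    unfolding u_def using level_normal(2)[of p t] assms(2) by metis
  moreover have "u \<bullet> rpt x < u \<bullet> rpt a"
    unfolding u_def using top_face_strict assms pairD by blast
  ultimately show False by (simp add: rpt_add rpt_diff inner_add_right inner_diff_right)
qed

text \<open>Points supplied by the pattern with a single topmost point at the side through them.\<close>
definition free :: "int \<times> int \<Rightarrow> bool" where
  "free p \<longleftrightarrow> (\<exists>P\<in>{A, B}. \<exists>a. top_face (level_normal (height p)) P = {a} \<and>
      (\<forall>x\<in>P. height (p - a + x) \<le> height p))"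

lemma hull_move:
  assumes "b \<in> Q" "b' \<in> Q" "0 \<le> r" "r \<le> 1"
  shows "rpt b + r *\<^sub>R (rpt b' - rpt b) \<in> lattice_hull Q"
proof -
  have "(1 - r) *\<^sub>R rpt b + r *\<^sub>R rpt b' \<in> lattice_hull Q"
    using assms by (intro convexD[OF convex_lattice_hull] rpt_in_lattice_hull) auto
  then show ?thesis by (simp add: algebra_simps)
qed

text \<open>Let \<open>b\<close> be the single topmost point of \<open>Q\<close> at this level. Then
  \<open>radial p\<close> splits as \<open>e + rpt b\<close>, and for \<open>t \<ge> 1\<close> the
  copy of \<open>Q\<close> shrunk by \<open>1 / t\<close> towards \<open>b\<close> stays in the hull
  of \<open>Q\<close>, so the whole translate stays within level \<open>t\<close>.\<close>

lemma free_above: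
  assumes "1 \<le> height p"
  shows "free p"
proof -
  define t where "t = height p"
  define u where "u = level_normal t"
  have u: "u \<in> stable_normals" "u \<bullet> (rpt p - c) = t * Y u"
    unfolding u_def using level_normal[of p t] t_def by auto
  obtain P Q b where PQ: "pair P Q" and b: "top_face u Q = {b}"
    using sharp_of_level[OF u(1)] pair_A_B pair_B_A by metis
  have t: "t \<ge> 1" "t > 0" using assms by (simp_all add: t_def)
  have rad: "rpt p - c = t *\<^sub>R (radial p - q)" using rpt_radial t_def by simp
  then have "u \<bullet> (radial p - q) = Y u" using u(2) t by simp
  then obtain e f where ef: "radial p = e + f" "e \<in> lattice_hull (top_face u P)" "f \<in> lattice_hull {b}"
    using top_decomposition[OF PQ radial_in_X] b by metis
  have "top_face u P \<subseteq> P" by (auto simp: top_face_def)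
  then have e: "e \<in> lattice_hull P"
    using ef(2) hull_mono[of "rpt ` top_face u P" "rpt ` P"] by (auto simp: lattice_hull_rpt)
  have f: "f = rpt b" using ef by (simp add: lattice_hull_singleton)
  have bQ: "b \<in> Q" using b by (auto simp: top_face_def)
  have "height (p - b + x) \<le> t" if x: "x \<in> Q" for x
  proof (rule height_le[OF t(2)])
    have "rpt (p - b + x) - c = t *\<^sub>R (radial p - q) + (rpt x - rpt b)"
      using rad by (simp add: rpt_add rpt_diff algebra_simps)
    then have "q + (1 / t) *\<^sub>R (rpt (p - b + x) - c) = e + (rpt b + (1 / t) *\<^sub>R (rpt x - rpt b))"
      using t by (simp add: ef f scaleR_add_right)
    then show "q + (1 / t) *\<^sub>R (rpt (p - b + x) - c) \<in> X"
      using e hull_move[OF bQ x, of "1 / t"] t pairD(5)[OF PQ] by auto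
  qed
  then show ?thesis
    unfolding free_def using b pairD(8)[OF PQ] unfolding u_def t_def by blast
qed

text \<open>A topmost \<open>a\<close> is at least as far in the direction of the level as
  \<open>x0\<close>, which lies on the side; \<open>inner_le_height\<close> then forces height at
  least \<open>t\<close>.\<close>

lemma level_max:
  assumes PQ: "pair P Q" and le: "\<And>x. x \<in> P \<Longrightarrow> height (v + x) \<le> t"
    and x0: "x0 \<in> P" "height (v + x0) = t" and a: "a \<in> top_face (level_normal t) P"
  shows "height (v + a) = t"
proof -
  define u where "u = level_normal t"
  have u: "u \<in> stable_normals" "u \<bullet> (rpt (v + x0) - c) = t * Y u"
    unfolding u_def using level_normal[OF x0(2)] x0 by auto
  have "u \<bullet> rpt x0 \<le> u \<bullet> rpt a"
    using a support_value_ge[OF pairD(1)[OF PQ] x0(1), of u] by (simp add: u_def top_face_def)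
  then have "t * Y u \<le> u \<bullet> (rpt (v + a) - c)"
    using u(2) by (simp add: rpt_add inner_add_right inner_diff_right)
  also have "\<dots> \<le> height (v + a) * Y u" by (rule inner_le_height)
  finally have "t \<le> height (v + a)"
    using clearance_pos[OF stable_normals_nonzero[OF u(1)]] by simp
  then show ?thesis using le[of a] a by (simp add: top_face_def)
qed

text \<open>
  If \<open>P\<close> touches the side of level \<open>t\<close> along an edge, then that edge, being a copy of a side of the
  hull of \<open>P\<close>, fits into \<open>t\<close> times itself, which forces \<open>1 \<le> t\<close>.
\<close>
lemma edge_fits:
  assumes PQ: "pair P Q" and le: "\<And>x. x \<in> P \<Longrightarrow> height (v + x) \<le> t"
    and x0: "x0 \<in> P" "height (v + x0) = t"
    and flat: "\<nexists>a. top_face (level_normal t) P = {a}"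
    and b: "top_face (level_normal t) Q = {b}"
  shows "1 \<le> t" "\<And>x y. x \<in> P \<Longrightarrow> y \<in> Q \<Longrightarrow> height (v - b + x + y) \<le> t"
proof -
  define u where "u = level_normal t"
  define F where "F = top_face u P"
  define r where "r = rot u"
  have u: "u \<in> stable_normals" "u \<noteq> 0"
    unfolding u_def using level_normal[OF x0(2)] stable_normals_nonzero by auto
  have t0: "0 < t" using height_pos x0(2) by metis
  have finF: "finite F" "F \<noteq> {}" "F \<subseteq> P"
    unfolding F_def using pairD[OF PQ] top_face_nonempty by (auto simp: top_face_def)
  have bQ: "b \<in> Q" using b by (auto simp: top_face_def)
  \<comment> \<open>Every topmost point of the translate lands on the side of level
    \<open>t\<close>. Scaled back by \<open>1 / t\<close>, it is \<open>rpt b\<close> plus a point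
    \<open>e\<close> of the edge of \<open>P\<close>.\<close>
  have position: "\<exists>e \<in> lattice_hull F. rpt (v + a) - c = t *\<^sub>R (e + rpt b - q)" if a: "a \<in> F" for a
  proof -
    have h: "height (v + a) = t" using level_max[OF PQ le x0] a by (simp add: F_def u_def)
    then have rad: "rpt (v + a) - c = t *\<^sub>R (radial (v + a) - q)" using rpt_radial by metis
    moreover have "u \<bullet> (rpt (v + a) - c) = t * Y u" unfolding u_def using level_normal(2)[OF h h] .
    ultimately have "u \<bullet> (radial (v + a) - q) = Y u" using t0 by simp
    then obtain e f where "radial (v + a) = e + f" "e \<in> lattice_hull F" "f \<in> lattice_hull {b}"
      using top_decomposition[OF PQ radial_in_X] b unfolding F_def u_def by metis
    then show ?thesis using rad by (auto simp: lattice_hull_singleton)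
  qed
  \<comment> \<open>\<open>a1\<close> and \<open>a2\<close> are the ends of the edge, since
    \<open>r\<close> runs along it.\<close>
  obtain a1 where a1: "a1 \<in> top_face r F" using top_face_nonempty finF by blast
  obtain a2 where a2: "a2 \<in> top_face (- r) F" using top_face_nonempty finF by blast
  have aF: "a1 \<in> F" "a2 \<in> F" using a1 a2 by (auto simp: top_face_def)
  have aP: "a1 \<in> P" "a2 \<in> P" using aF finF by auto
  obtain e1 where e1: "e1 \<in> lattice_hull F" "rpt (v + a1) - c = t *\<^sub>R (e1 + rpt b - q)"
    using position[OF aF(1)] by blast
  obtain e2 where e2: "e2 \<in> lattice_hull F" "rpt (v + a2) - c = t *\<^sub>R (e2 + rpt b - q)"
    using position[OF aF(2)] by blast
  define w where "w = rpt a1 - rpt a2"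
  \<comment> \<open>The edge vector is \<open>t\<close> times a difference of two points of the same
    edge; this will force \<open>1 \<le> t\<close>.\<close>
  have t_diff: "w = t *\<^sub>R (e1 - e2)"
  proof -
    have "w = (rpt (v + a1) - c) - (rpt (v + a2) - c)" by (simp add: w_def rpt_add)
    also have "\<dots> = t *\<^sub>R (e1 - e2)" unfolding e1(2) e2(2) by (simp add: algebra_simps)
    finally show ?thesis .
  qed
  have top_r: "r \<bullet> e1 \<le> r \<bullet> rpt a1"
    using lattice_hull_le_support[OF finF(1) e1(1), of r] a1 by (simp add: top_face_def)
  have bot_r: "r \<bullet> rpt a2 \<le> r \<bullet> e2"
    using lattice_hull_le_support[OF finF(1) e2(1), of "- r"] a2 by (simp add: top_face_def)
  have uF: "u \<bullet> rpt a = support_value u P" if "a \<in> F" for a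
    using that by (simp add: F_def top_face_def)
  \<comment> \<open>Otherwise all topmost points would agree in both the \<open>u\<close> and the
    \<open>r\<close> coordinate and so be a single point.\<close>
  have w_pos: "0 < r \<bullet> w"
  proof (rule ccontr)
    assume neg: "\<not> 0 < r \<bullet> w"
    have "a = a1" if a: "a \<in> F" for a
    proof -
      have "r \<bullet> rpt a \<le> r \<bullet> rpt a1" "r \<bullet> rpt a2 \<le> r \<bullet> rpt a"
        using support_value_ge[OF finF(1) a, of r] support_value_ge[OF finF(1) a, of "- r"] a1 a2
        by (simp_all add: top_face_def)
      then have "r \<bullet> rpt a = r \<bullet> rpt a1" using neg by (simp add: w_def inner_diff_right)
      then have "rpt a = rpt a1"
        using uF[OF a] uF[OF aF(1)] u(2) plane_vector_eqI[of u "rpt a" "rpt a1"] by (simp add: r_def)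
      then show ?thesis by (simp add: rpt_inject)
    qed
    then have "top_face u P = {a1}" using aF unfolding F_def by blast
    then show False using flat unfolding u_def by blast
  qed
  have rw: "r \<bullet> w = t * (r \<bullet> e1 - r \<bullet> e2)" using t_diff by (simp add: inner_diff_right)
  have "r \<bullet> e1 - r \<bullet> e2 \<le> r \<bullet> w"
    using top_r bot_r by (simp add: w_def inner_diff_right)
  then have "r \<bullet> w \<le> t * (r \<bullet> w)" unfolding rw[symmetric]
    using t0 rw by (metis mult_left_mono less_imp_le)
  then show t1: "1 \<le> t" using w_pos by simp
  \<comment> \<open>The relative distance of \<open>e1\<close> from the end \<open>a1\<close>. The
    bound \<open>\<sigma> + 1 / t \<le> 1\<close> says that the edge shrunk by \<open>1 / t\<close>,
    with its end \<open>a1\<close> placed at \<open>e1\<close>, stays inside the edge.\<close>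
  define \<sigma> where "\<sigma> = (r \<bullet> rpt a1 - r \<bullet> e1) / (r \<bullet> w)"
  have \<sigma>0: "0 \<le> \<sigma>" unfolding \<sigma>_def using top_r w_pos by simp
  have "(r \<bullet> rpt a1 - r \<bullet> e1) + (r \<bullet> w) / t \<le> r \<bullet> w"
  proof -
    have "(r \<bullet> w) / t = r \<bullet> e1 - r \<bullet> e2" using rw t0 by simp
    then show ?thesis using bot_r by (simp add: w_def inner_diff_right)
  qed
  then have "\<sigma> * (r \<bullet> w) + (1 / t) * (r \<bullet> w) \<le> r \<bullet> w" using w_pos by (simp add: \<sigma>_def)
  then have "(\<sigma> + 1 / t) * (r \<bullet> w) \<le> 1 * (r \<bullet> w)" by (simp only: distrib_right mult_1)
  then have \<sigma>1: "\<sigma> + 1 / t \<le> 1" using w_pos by (simp only: mult_le_cancel_right_pos)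
  have e1_eq: "e1 = rpt a1 - \<sigma> *\<^sub>R w"
  proof (rule plane_vector_eqI[OF u(2)])
    have "lattice_hull F \<subseteq> {x. u \<bullet> x = support_value u P}"
      unfolding lattice_hull_rpt
      by (intro hull_minimal convex_hyperplane image_subsetI CollectI uF)
    then show "u \<bullet> e1 = u \<bullet> (rpt a1 - \<sigma> *\<^sub>R w)"
      using e1(1) uF aF by (auto simp: w_def inner_diff_right)
    show "rot u \<bullet> e1 = rot u \<bullet> (rpt a1 - \<sigma> *\<^sub>R w)"
      using w_pos by (simp add: \<sigma>_def r_def[symmetric] inner_diff_right)
  qed
  show "height (v - b + x + y) \<le> t" if x: "x \<in> P" and y: "y \<in> Q" for x y
  proof (rule height_le[OF t0])
    have "rpt (v - b + x + y) - c = (rpt (v + a1) - c) + (rpt x - rpt a1) + (rpt y - rpt b)"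
      by (simp add: rpt_add rpt_diff algebra_simps)
    then have eq: "q + (1 / t) *\<^sub>R (rpt (v - b + x + y) - c) =
        (e1 + (1 / t) *\<^sub>R (rpt x - rpt a1)) + (rpt b + (1 / t) *\<^sub>R (rpt y - rpt b))"
      unfolding e1(2) using t0 by (simp add: scaleR_add_right)
    have "e1 + (1 / t) *\<^sub>R (rpt x - rpt a1) =
        (1 - \<sigma> - 1 / t) *\<^sub>R rpt a1 + \<sigma> *\<^sub>R rpt a2 + (1 / t) *\<^sub>R rpt x"
      unfolding e1_eq w_def by (simp add: algebra_simps)
    also have "\<dots> \<in> lattice_hull P"
    proof -
      \<comment> \<open>The convex combination of three points is formed in two steps, joining
        \<open>a2\<close> and \<open>x\<close> first.\<close>
      have "\<exists>z\<in>lattice_hull P. \<sigma> *\<^sub>R rpt a2 + (1 / t) *\<^sub>R rpt x = (\<sigma> + 1 / t) *\<^sub>R z"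
      proof -
        have pos: "0 < \<sigma> + 1 / t" using \<sigma>0 t0 by (simp add: add_nonneg_pos)
        have sum1: "\<sigma> / (\<sigma> + 1 / t) + (1 / t) / (\<sigma> + 1 / t) = 1"
          unfolding add_divide_distrib[symmetric] using pos by simp
        have "(\<sigma> / (\<sigma> + 1 / t)) *\<^sub>R rpt a2 + ((1 / t) / (\<sigma> + 1 / t)) *\<^sub>R rpt x \<in> lattice_hull P"
          by (rule convexD[OF convex_lattice_hull])
            (use \<sigma>0 t0 pos aP x sum1 in \<open>simp_all add: rpt_in_lattice_hull\<close>)
        moreover have "\<sigma> *\<^sub>R rpt a2 + (1 / t) *\<^sub>R rpt x =
            (\<sigma> + 1 / t) *\<^sub>R ((\<sigma> / (\<sigma> + 1 / t)) *\<^sub>R rpt a2 + ((1 / t) / (\<sigma> + 1 / t)) *\<^sub>R rpt x)"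
          using pos by (simp add: scaleR_add_right)
        ultimately show ?thesis by blast
      qed
      then obtain z where z: "z \<in> lattice_hull P"
        "\<sigma> *\<^sub>R rpt a2 + (1 / t) *\<^sub>R rpt x = (\<sigma> + 1 / t) *\<^sub>R z" by blast
      have "(1 - (\<sigma> + 1 / t)) *\<^sub>R rpt a1 + (\<sigma> + 1 / t) *\<^sub>R z \<in> lattice_hull P"
        using \<sigma>0 \<sigma>1 t0 aP z(1)
        by (intro convexD[OF convex_lattice_hull] rpt_in_lattice_hull) auto
      then show ?thesis using z(2) by (simp add: add.assoc diff_diff_eq)
    qed
    finally show "q + (1 / t) *\<^sub>R (rpt (v - b + x + y) - c) \<in> X"
      unfolding eq using hull_move[OF bQ y, of "1 / t"] t0 t1 pairD(5)[OF PQ] by auto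
  qed
qed

section \<open>Charging translates injectively\<close>

definition top_height :: "int \<times> int \<Rightarrow> (int \<times> int) set \<Rightarrow> real" where
  "top_height v P = Max ((\<lambda>x. height (v + x)) ` P)"

lemma top_height:
  assumes "finite P" "P \<noteq> {}"
  shows "\<And>x. x \<in> P \<Longrightarrow> height (v + x) \<le> top_height v P" "\<exists>x\<in>P. height (v + x) = top_height v P"
proof -
  show "height (v + x) \<le> top_height v P" if "x \<in> P" for x
    unfolding top_height_def using assms that by simp
  have "top_height v P \<in> (\<lambda>x. height (v + x)) ` P"
    unfolding top_height_def using assms by (intro Max_in) auto
  then obtain x where "top_height v P = height (v + x)" "x \<in> P" by (rule imageE)
  then show "\<exists>x\<in>P. height (v + x) = top_height v P" by auto
qed

lemma top_height_eqI:
  assumes "finite P" "\<And>x. x \<in> P \<Longrightarrow> height (v + x) \<le> t" "x0 \<in> P" "height (v + x0) = t"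
  shows "top_height v P = t"
  unfolding top_height_def using assms by (intro Max_eqI) auto

definition double_height :: "int \<times> int \<Rightarrow> real" where
  "double_height w = Max (\<Union>a\<in>A. (\<lambda>b. height (w + a + b)) ` B)"

lemma double_height_eqI:
  assumes "pair P Q" "\<And>x y. x \<in> P \<Longrightarrow> y \<in> Q \<Longrightarrow> height (w + x + y) \<le> t"
    and "x0 \<in> P" "y0 \<in> Q" "height (w + x0 + y0) = t"
  shows "double_height w = t"
proof -
  have swap: "height (w + x + y) = height (w + y + x)" for x y by (simp add: algebra_simps)
  have "height (w + a + b) \<le> t" if "a \<in> A" "b \<in> B" for a b
    using assms(1,2) that swap unfolding pair_def by metis
  moreover obtain a b where "a \<in> A" "b \<in> B" "height (w + a + b) = t"
    using assms(1,3-5) swap unfolding pair_def by metis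
  ultimately show ?thesis
    unfolding double_height_def using fin by (intro Max_eqI) auto
qed

text \<open>Meaningful only under \<open>sharp\<close>, where the top face has a single
  element.\<close>

definition peak :: "real \<Rightarrow> (int \<times> int) set \<Rightarrow> int \<times> int" where
  "peak t P = the_elem (top_face (level_normal t) P)"

definition sharp :: "real \<Rightarrow> (int \<times> int) set \<Rightarrow> bool" where
  "sharp t P \<longleftrightarrow> (\<exists>a. top_face (level_normal t) P = {a})"

lemma sharp_peak: "sharp t P \<Longrightarrow> top_face (level_normal t) P = {peak t P}"
  unfolding sharp_def peak_def by (elim exE) (simp only: the_elem_eq)

lemma peak_mem: "sharp t P \<Longrightarrow> peak t P \<in> P"
  using sharp_peak[of t P] unfolding top_face_def by blast

lemma sharp_exclusive:
  assumes "pair P Q" "height y = t"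
  shows "sharp t P \<longleftrightarrow> \<not> sharp t Q"
  unfolding sharp_def using pair_sharp[OF level_normal(1)[OF assms(2)] assms(1)] by simp

text \<open>
  A translate is charged to the point which it supplies or, if it touches its level along an edge, to
  a translate of \<open>A + B\<close>.
\<close>
definition mark :: "(int \<times> int) set \<Rightarrow> (int \<times> int) set \<Rightarrow> int \<times> int \<Rightarrow> (int \<times> int) + (int \<times> int)" where
  "mark P Q v = (let t = top_height v P in if sharp t P then Inl (v + peak t P) else Inr (v - peak t Q))"

text \<open>In both cases the mark retains the level of the translate: \<open>p\<close> has its
  greatest height, and by \<open>edge_fits\<close> the translate of \<open>A + B\<close> at
  \<open>w\<close> reaches the same height. Hence \<open>v\<close> can be read off from the
  mark.\<close>

lemma mark_cases:
  assumes PQ: "pair P Q"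
  obtains (sharp) p where "mark P Q v = Inl p" "free p" "sharp (height p) P"
      "v = p - peak (height p) P" "\<exists>x\<in>P. p = v + x"
  | (flat) w where "mark P Q v = Inr w" "1 \<le> double_height w" "sharp (double_height w) Q"
      "\<not> sharp (double_height w) P" "v = w + peak (double_height w) Q"
      "\<And>a b. a \<in> A \<Longrightarrow> b \<in> B \<Longrightarrow> height (w + a + b) \<le> double_height w"
      "\<exists>x\<in>P. height (v + x) = double_height w"
proof -
  define t where "t = top_height v P"
  have le: "\<And>x. x \<in> P \<Longrightarrow> height (v + x) \<le> t"
    unfolding t_def by (rule top_height(1)[OF pairD(1,3)[OF PQ]])
  obtain x0 where x0: "x0 \<in> P" "height (v + x0) = t"
    unfolding t_def using top_height(2)[OF pairD(1,3)[OF PQ]] by blast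
  show ?thesis
  proof (cases "sharp t P")
    case True
    define p where "p = v + peak t P"
    have top: "top_face (level_normal t) P = {peak t P}" using sharp_peak[OF True] .
    then have h: "height p = t" unfolding p_def using level_max[OF PQ le x0] by simp
    have "free p"
      unfolding free_def h using top pairD(7)[OF PQ] le
      by (intro bexI[of _ P] exI[of _ "peak t P"]) (simp_all add: p_def)
    show ?thesis
    proof (rule sharp[of p])
      show "mark P Q v = Inl p" using True by (simp add: mark_def t_def[symmetric] p_def)
      show "free p" by fact
      show "sharp (height p) P" using True h by metis
      show "v = p - peak (height p) P" unfolding h by (simp add: p_def)
      show "\<exists>x\<in>P. p = v + x" using peak_mem[OF True] p_def by blast
    qed
  next
    case False
    then have Q: "sharp t Q" using sharp_exclusive[OF PQ x0(2)] by simp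
    define b where "b = peak t Q"
    define w where "w = v - b"
    have b: "top_face (level_normal t) Q = {b}" "b \<in> Q"
      unfolding b_def using sharp_peak[OF Q] peak_mem[OF Q] by auto
    have flat': "\<nexists>a. top_face (level_normal t) P = {a}" using False by (simp add: sharp_def)
    note ef = edge_fits[OF PQ le x0 flat' b(1)]
    have eq: "w + x0 + b = v + x0" by (simp add: w_def)
    have dh: "double_height w = t"
      using double_height_eqI[OF PQ, of w t x0 b] ef(2) x0 b(2) eq by (simp add: w_def)
    show ?thesis
    proof (rule flat[of w], unfold dh)
      show "mark P Q v = Inr w" using False by (simp add: mark_def t_def[symmetric] w_def b_def)
      show "1 \<le> t" by (rule ef(1))
      show "sharp t Q" "\<not> sharp t P" by (fact Q, fact False)
      show "v = w + peak t Q" by (simp add: w_def b_def)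
      show "height (w + x + y) \<le> t" if "x \<in> A" "y \<in> B" for x y
      proof -
        have swap: "w + x + y = w + y + x" by (simp add: algebra_simps)
        show ?thesis
          using ef(2)[of x y] ef(2)[of y x] that PQ swap unfolding pair_def w_def by metis
      qed
      show "\<exists>x\<in>P. height (v + x) = t" using x0 by blast
    qed
  qed
qed

text \<open>Since \<open>X\<close> is bounded, a bound on the height bounds the distance from the
  centre.\<close>

lemma finite_sublevel: "finite {x. height x \<le> T}"
proof -
  obtain M where M: "\<And>\<xi>. \<xi> \<in> X \<Longrightarrow> norm \<xi> \<le> M"
    using compact_imp_bounded[OF compact_X] by (auto simp: bounded_iff)
  have "{x. height x \<le> T} \<subseteq> {x. norm (rpt x - c) \<le> T * (M + norm q)}"
  proof
    fix x assume x: "x \<in> {x. height x \<le> T}"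
    have "norm (radial x - q) \<le> M + norm q"
      using M[OF radial_in_X[of x]] norm_triangle_ineq4[of "radial x" q] by linarith
    then have "height x * norm (radial x - q) \<le> T * (M + norm q)"
      using x height_pos[of x] by (intro mult_mono) auto
    then show "x \<in> {x. norm (rpt x - c) \<le> T * (M + norm q)}"
      using height_pos[of x] by (simp add: rpt_radial)
  qed
  then show ?thesis using finite_bounded_lattice finite_subset by blast
qed

text \<open>The two sums have different meanings: \<open>Inl\<close> and \<open>Inr\<close> are
  translates of \<open>A\<close> and \<open>B\<close> in the argument, but supplied points and
  translates of \<open>A + B\<close> in the result.\<close>

definition mark_sum :: "(int \<times> int) + (int \<times> int) \<Rightarrow> (int \<times> int) + (int \<times> int)" where
  "mark_sum z = (case z of Inl v \<Rightarrow> mark A B v | Inr v \<Rightarrow> mark B A v)"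

text \<open>At each level exactly one pattern is sharp. A supplied point comes from the sharp
  pattern, a translate of \<open>A + B\<close> from the other one.\<close>

definition unmark :: "(int \<times> int) + (int \<times> int) \<Rightarrow> (int \<times> int) + (int \<times> int)" where
  "unmark z = (case z of
      Inl p \<Rightarrow> if sharp (height p) A then Inl (p - peak (height p) A) else Inr (p - peak (height p) B)
    | Inr w \<Rightarrow> if sharp (double_height w) A then Inr (w + peak (double_height w) A)
        else Inl (w + peak (double_height w) B))"

lemma unmark_mark_sum: "unmark (mark_sum z) = z"
proof (cases z)
  case (Inl v)
  show ?thesis
  proof (cases rule: mark_cases[OF pair_A_B, of v])
    case (1 p)
    then show ?thesis by (simp add: Inl mark_sum_def unmark_def)
  next
    case (2 w)
    then show ?thesis by (simp add: Inl mark_sum_def unmark_def)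
  qed
next
  case (Inr v)
  show ?thesis
  proof (cases rule: mark_cases[OF pair_B_A, of v])
    case (1 p)
    then show ?thesis
      using sharp_exclusive[OF pair_B_A refl, of p] by (simp add: Inr mark_sum_def unmark_def)
  next
    case (2 w)
    then show ?thesis by (simp add: Inr mark_sum_def unmark_def)
  qed
qed

lemma inj_mark_sum: "inj_on mark_sum Z"
  by (rule inj_on_inverseI[where g = unmark]) (rule unmark_mark_sum)

lemma mark_in:
  assumes PQ: "pair P Q" and R: "\<And>x y. x \<in> R \<Longrightarrow> height y \<le> height x \<Longrightarrow> y \<in> R"
    and v: "(+) v ` P \<subseteq> R"
  shows "mark P Q v \<in> {p \<in> R. free p} <+> double_translates A B R"
proof (cases rule: mark_cases[OF PQ, of v])
  case (1 p)
  obtain x where x: "x \<in> P" "p = v + x" using 1(5) by blast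
  then have "p \<in> {p \<in> R. free p}" using v 1(2) by blast
  then show ?thesis unfolding 1(1) by (rule InlI)
next
  case (2 w)
  obtain x where x: "x \<in> P" "height (v + x) = double_height w" using 2(7) by blast
  then have "v + x \<in> R" using v by blast
  then have "w + a + b \<in> R" if "a \<in> A" "b \<in> B" for a b
    using R 2(6)[OF that] x(2) by metis
  then have "w \<in> double_translates A B R" unfolding double_translates_def by blast
  then show ?thesis unfolding 2(1) by (rule InrI)
qed

text \<open>Injectivity of the charge gives this. Combined with the parity bound, the counts of
  translates of \<open>A\<close>, \<open>B\<close> and \<open>A + B\<close> all cancel.\<close>

lemma card_translates_le:
  assumes R: "finite R" "\<And>x y. x \<in> R \<Longrightarrow> height y \<le> height x \<Longrightarrow> y \<in> R"
  shows "card {v. (+) v ` A \<subseteq> R} + card {v. (+) v ` B \<subseteq> R}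
    \<le> card {p \<in> R. free p} + card (double_translates A B R)"
proof -
  let ?F = "{v. (+) v ` A \<subseteq> R}" and ?G = "{v. (+) v ` B \<subseteq> R}"
  let ?D = "{p \<in> R. free p} <+> double_translates A B R"
  obtain a b where ab: "a \<in> A" "b \<in> B" using ne by blast
  have "double_translates A B R \<subseteq> (\<lambda>x. x - (a + b)) ` R"
  proof
    fix w assume "w \<in> double_translates A B R"
    then have "w + a + b \<in> R" using ab by (auto simp: double_translates_def)
    then show "w \<in> (\<lambda>x. x - (a + b)) ` R" by (intro image_eqI[of _ _ "w + a + b"]) auto
  qed
  then have finD: "finite (double_translates A B R)" using R(1) finite_surj by blast
  have "mark_sum ` (?F <+> ?G) \<subseteq> ?D"
  proof (rule image_subsetI)
    fix z assume "z \<in> ?F <+> ?G"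
    then consider v where "z = Inl v" "(+) v ` A \<subseteq> R" | v where "z = Inr v" "(+) v ` B \<subseteq> R" by blast
    then show "mark_sum z \<in> ?D"
    proof cases
      case 1
      then show ?thesis using mark_in[OF pair_A_B R(2)] by (simp add: mark_sum_def)
    next
      case 2
      then show ?thesis using mark_in[OF pair_B_A R(2)] by (simp add: mark_sum_def)
    qed
  qed
  then have "card (?F <+> ?G) \<le> card ?D"
    using R(1) finD by (intro card_inj_on_le[OF inj_mark_sum]) auto
  then show ?thesis
    using R(1) finD finite_translates[OF R(1)] ne by (simp add: card_Plus)
qed

lemma mark_free:
  assumes PQ: "pair P Q" and a: "top_face (level_normal (height p)) P = {a}"
    and le: "\<And>x. x \<in> P \<Longrightarrow> height (p - a + x) \<le> height p"
  shows "mark P Q (p - a) = Inl p"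
proof -
  have aP: "a \<in> P" using a unfolding top_face_def by blast
  have t: "top_height (p - a) P = height p"
    using top_height_eqI[OF pairD(1)[OF PQ] le aP] by simp
  have s: "sharp (height p) P" using a sharp_def by blast
  then have "peak (height p) P = a" using sharp_peak a by simp
  then show ?thesis using s by (simp add: mark_def t Let_def)
qed

text \<open>Below height 1 the flat case of \<open>mark_cases\<close> cannot occur, and each free
  point is the mark of the translate that supplies it, so the charge is a bijection onto the free
  points.\<close>

lemma card_translates_below:
  defines "R \<equiv> {x. height x < 1}"
  shows "card {v. (+) v ` A \<subseteq> R} + card {v. (+) v ` B \<subseteq> R} = card {p \<in> R. free p}"
proof -
  let ?F = "{v. (+) v ` A \<subseteq> R}" and ?G = "{v. (+) v ` B \<subseteq> R}"
  have "R \<subseteq> {x. height x \<le> 1}" by (auto simp: R_def)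
  then have finR: "finite R" using finite_sublevel finite_subset by blast
  have mark_Inl: "mark P Q v \<in> Inl ` {p \<in> R. free p}" if PQ: "pair P Q" and v: "(+) v ` P \<subseteq> R" for P Q v
  proof (cases rule: mark_cases[OF PQ, of v])
    case (1 p)
    obtain x where x: "x \<in> P" "p = v + x" using 1(5) by blast
    then have "p \<in> {p \<in> R. free p}" using v 1(2) by blast
    then show ?thesis unfolding 1(1) by (rule imageI)
  next
    case (2 w)
    obtain x where x: "x \<in> P" "height (v + x) = double_height w" using 2(7) by blast
    then have "double_height w < 1" using v unfolding R_def by auto
    then show ?thesis using 2(2) by simp
  qed
  have "mark_sum ` (?F <+> ?G) = Inl ` {p \<in> R. free p}"
  proof
    show "mark_sum ` (?F <+> ?G) \<subseteq> Inl ` {p \<in> R. free p}"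
    proof (rule image_subsetI)
      fix z assume "z \<in> ?F <+> ?G"
      then consider v where "z = Inl v" "(+) v ` A \<subseteq> R" | v where "z = Inr v" "(+) v ` B \<subseteq> R" by blast
      then show "mark_sum z \<in> Inl ` {p \<in> R. free p}"
      proof cases
        case 1
        then show ?thesis using mark_Inl[OF pair_A_B] by (simp add: mark_sum_def)
      next
        case 2
        then show ?thesis using mark_Inl[OF pair_B_A] by (simp add: mark_sum_def)
      qed
    qed
    show "Inl ` {p \<in> R. free p} \<subseteq> mark_sum ` (?F <+> ?G)"
    proof (rule image_subsetI)
      fix p assume "p \<in> {p \<in> R. free p}"
      then have p: "height p < 1" "free p" by (auto simp: R_def)
      then obtain P a where P: "P \<in> {A, B}" and a: "top_face (level_normal (height p)) P = {a}"
        and le: "\<And>x. x \<in> P \<Longrightarrow> height (p - a + x) \<le> height p"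
        unfolding free_def by blast
      have sub: "(+) (p - a) ` P \<subseteq> R"
        unfolding R_def using le p(1) by fastforce
      show "Inl p \<in> mark_sum ` (?F <+> ?G)"
      proof (cases "P = A")
        case True
        have "Inl p = mark_sum (Inl (p - a))"
          using mark_free[OF pair_A_B] a le by (simp add: mark_sum_def True)
        moreover have "Inl (p - a) \<in> ?F <+> ?G" using sub True by blast
        ultimately show ?thesis by (rule image_eqI)
      next
        case False
        then have "P = B" using P by blast
        have "Inl p = mark_sum (Inr (p - a))"
          using mark_free[OF pair_B_A] a le by (simp add: mark_sum_def \<open>P = B\<close>)
        moreover have "Inr (p - a) \<in> ?F <+> ?G" using sub \<open>P = B\<close> by blast
        ultimately show ?thesis by (rule image_eqI)
      qed
    qed
  qed
  moreover have "card (mark_sum ` (?F <+> ?G)) = card (?F <+> ?G)" by (rule card_image[OF inj_mark_sum])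
  moreover have "card (Inl ` {p \<in> R. free p} :: ((int \<times> int) + (int \<times> int)) set) = card {p \<in> R. free p}"
    by (rule card_image) simp
  ultimately have "card (?F <+> ?G) = card {p \<in> R. free p}" by simp
  then show ?thesis
    using finite_translates[OF finR] ne by (simp add: card_Plus)
qed

section \<open>The seeds, their minimality and their number\<close>

definition seeds :: "(int \<times> int) set" where
  "seeds = {p. \<not> free p}"

lemma seeds_below: "seeds \<subseteq> {x. height x < 1}"
proof
  fix p assume "p \<in> seeds"
  then have "\<not> 1 \<le> height p" unfolding seeds_def using free_above by blast
  then show "p \<in> {x. height x < 1}" by simp
qed

lemma finite_seeds: "finite seeds"
  using seeds_below by (rule finite_subset) (rule finite_subset[OF _ finite_sublevel[of 1]], auto)

text \<open>A free point is supplied by a translate whose other points are strictly lower. Heights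
  are real, so the induction runs on the number of lower lattice points, which is finite.\<close>

lemma derivable_if_seeds:
  assumes R: "\<And>x y. x \<in> R \<Longrightarrow> height y \<le> height x \<Longrightarrow> y \<in> R"
    and seeds: "\<And>x. x \<in> R \<Longrightarrow> x \<in> seeds \<Longrightarrow> x \<in> derivable {A, B} R S"
    and p: "p \<in> R"
  shows "p \<in> derivable {A, B} R S"
  using p
proof (induction "card {x. height x < height p}" arbitrary: p rule: less_induct)
  case (less p)
  have finb: "finite {x. height x < T}" for T
    by (rule finite_subset[OF _ finite_sublevel[of T]]) auto
  show ?case
  proof (cases "p \<in> seeds")
    case True
    then show ?thesis using seeds less.prems by blast
  next
    case False
    then have "free p" by (simp add: seeds_def)
    then obtain P a where P: "P \<in> {A, B}" and a: "top_face (level_normal (height p)) P = {a}"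
      and le: "\<And>x. x \<in> P \<Longrightarrow> height (p - a + x) \<le> height p"
      unfolding free_def by blast
    obtain Q where PQ: "pair P Q" using P pair_A_B pair_B_A by blast
    have aP: "a \<in> P" using a unfolding top_face_def by blast
    show ?thesis
    proof (rule derivable.fill[OF P, where v = "p - a"])
      show "(+) (p - a) ` P \<subseteq> R" using R[OF less.prems] le by blast
      show "p \<in> (+) (p - a) ` P" using aP by (intro image_eqI[of _ _ a]) auto
      fix y assume "y \<in> (+) (p - a) ` P" "y \<noteq> p"
      then obtain x where x: "x \<in> P" "y = p - a + x" "x \<noteq> a" by auto
      have lt: "height y < height p"
        using sharp_below[OF PQ refl a x(1,3)] le[OF x(1)] x(2) by simp
      then have "{x. height x < height y} \<subset> {x. height x < height p}" by force
      then have "card {x. height x < height y} < card {x. height x < height p}"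
        using finb by (rule psubset_card_mono[rotated])
      then show "y \<in> derivable {A, B} R S"
        using less.hyps R[OF less.prems, of y] lt by simp
    qed
  qed
qed

lemma percolates_seeds: "percolates {A, B} seeds"
proof (rule derivable_imp_percolates)
  show "finite P" if "P \<in> {A, B}" for P using that fin by auto
  show "p \<in> derivable {A, B} UNIV seeds" for p
    by (rule derivable_if_seeds) (auto intro: derivable.seed)
qed

text \<open>A competing seed \<open>S\<close> derives the finitely many points of
  \<open>seeds\<close> inside some sublevel set and hence all of that set; there the parity bound
  meets the charging bound.\<close>

lemma card_seeds_le:
  assumes "finite S" "percolates {A, B} S"
  shows "card seeds \<le> card S"
proof -
  have "\<exists>T. p \<in> derivable {A, B} {x. height x \<le> T} S" for p
    using derivable_in_sublevel[of "{A, B}" p S height] percolates_imp_derivable[OF assms(2)] fin by blast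
  then obtain f where f: "\<And>p. p \<in> derivable {A, B} {x. height x \<le> f p} S" by metis
  \<comment> \<open>\<open>insert 1\<close> makes \<open>R\<close> contain all of
    \<open>seeds\<close>, whose heights are below 1.\<close>
  define T where "T = Max (insert 1 (f ` seeds))"
  define R where "R = {x. height x \<le> T}"
  have T: "f p \<le> T" if "p \<in> seeds" for p
    using that finite_seeds by (simp add: T_def)
  have T1: "1 \<le> T" using finite_seeds by (simp add: T_def)
  have R: "\<And>x y. x \<in> R \<Longrightarrow> height y \<le> height x \<Longrightarrow> y \<in> R" by (simp add: R_def)
  have finR: "finite R" unfolding R_def by (rule finite_sublevel)
  have sd: "x \<in> derivable {A, B} R S" if "x \<in> seeds" for x
    by (rule derivable_mono[OF _ f[of x]]) (use T[OF that] in \<open>simp add: R_def Collect_mono_iff\<close>)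
  have "R \<subseteq> derivable {A, B} R S"
  proof
    fix p assume "p \<in> R"
    then show "p \<in> derivable {A, B} R S" by (rule derivable_if_seeds[rotated 2]) (fact R, rule sd)
  qed
  then have "card R + card (double_translates A B R) \<le>
    card (S \<inter> R) + card {v. (+) v ` A \<subseteq> R} + card {v. (+) v ` B \<subseteq> R}"
    using card_le_derivable fin ne finR by blast
  moreover have "card {v. (+) v ` A \<subseteq> R} + card {v. (+) v ` B \<subseteq> R}
    \<le> card {p \<in> R. free p} + card (double_translates A B R)"
    by (rule card_translates_le[OF finR R])
  moreover have "card R = card {p \<in> R. free p} + card seeds"
  proof -
    have "seeds \<subseteq> R" using seeds_below T1 by (force simp: R_def)
    then have "R = {p \<in> R. free p} \<union> seeds" by (auto simp: seeds_def)
    then have "card R = card ({p \<in> R. free p} \<union> seeds)" by simp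
    also have "\<dots> = card {p \<in> R. free p} + card seeds"
      using finR finite_seeds by (intro card_Un_disjoint) (auto simp: seeds_def)
    finally show ?thesis .
  qed
  moreover have "card (S \<inter> R) \<le> card S" using assms(1) by (intro card_mono) auto
  ultimately show ?thesis by linarith
qed

text \<open>Cancellation for convex sets: if \<open>rpt v - s\<close> were outside the hull of
  \<open>Q\<close>, a separating direction and a topmost point of \<open>P\<close> in it would give
  a point beyond the support line of \<open>X\<close>.\<close>

lemma translates_below:
  assumes PQ: "pair P Q"
  shows "(+) v ` P \<subseteq> {x. height x < 1} \<longleftrightarrow> rpt v - s \<in> lattice_hull Q"
proof -
  have "(+) v ` P \<subseteq> {x. height x < 1} \<longleftrightarrow> (\<forall>a\<in>P. rpt v - s + rpt a \<in> X)"
  proof -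
    have "height x < 1 \<longleftrightarrow> rpt x - s \<in> X" for x
      using height_le_1_iff[of x] height_ne_1[of x] by auto
    then show ?thesis by (auto simp: rpt_add algebra_simps)
  qed
  also have "\<dots> \<longleftrightarrow> rpt v - s \<in> lattice_hull Q"
  proof
    assume "rpt v - s \<in> lattice_hull Q"
    then have "rpt a + (rpt v - s) \<in> X" if "a \<in> P" for a
      using that rpt_in_lattice_hull pairD(5)[OF PQ] by blast
    then show "\<forall>a\<in>P. rpt v - s + rpt a \<in> X" by (simp add: add.commute)
  next
    assume all: "\<forall>a\<in>P. rpt v - s + rpt a \<in> X"
    show "rpt v - s \<in> lattice_hull Q"
    proof (rule ccontr)
      define z where "z = rpt v - s"
      assume "rpt v - s \<notin> lattice_hull Q"
      moreover have "closed (lattice_hull Q)" "lattice_hull Q \<noteq> {}"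
        using compact_imp_closed compact_lattice_hull pairD[OF PQ] rpt_in_lattice_hull by blast+
      ultimately obtain w d where w: "w \<bullet> z < d" "\<And>x. x \<in> lattice_hull Q \<Longrightarrow> d < w \<bullet> x"
        using separating_hyperplane_closed_point[OF convex_lattice_hull] unfolding z_def by metis
      obtain a where a: "a \<in> top_face (- w) P" using top_face_nonempty pairD[OF PQ] by blast
      obtain b where b: "b \<in> top_face (- w) Q" using top_face_nonempty pairD[OF PQ] by blast
      have "z + rpt a \<in> X" using all a unfolding z_def top_face_def by blast
      then have "(- w) \<bullet> (z + rpt a - q) \<le> Y (- w)" by (rule X_le_clearance)
      then have "(- w) \<bullet> z \<le> (- w) \<bullet> rpt b"
        using a b pairD(6)[OF PQ, of "- w"] by (simp add: top_face_def inner_add_right inner_diff_right)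
      moreover have "d < w \<bullet> rpt b"
        using w(2) b rpt_in_lattice_hull unfolding top_face_def by blast
      ultimately show False using w(1) by simp
    qed
  qed
  finally show ?thesis .
qed

text \<open>The region below height 1 is the shifted \<open>X\<close>. Its free points are as many
  as the translates inside it, where translates of one pattern correspond to lattice points in the
  shifted hull of the other.\<close>

lemma card_seeds:
  "card seeds + card {x. rpt x - s \<in> lattice_hull A} + card {x. rpt x - s \<in> lattice_hull B}
    = card {x. rpt x - s \<in> lattice_hull A + lattice_hull B}"
proof -
  define R where "R = {x. height x < 1}"
  have finR: "finite R"
    unfolding R_def by (rule finite_subset[OF _ finite_sublevel[of 1]]) auto
  have "height x < 1 \<longleftrightarrow> rpt x - s \<in> X" for x
    using height_le_1_iff[of x] height_ne_1[of x] by auto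
  then have R: "R = {x. rpt x - s \<in> lattice_hull A + lattice_hull B}" by (simp add: R_def X_def)
  have F: "{v. (+) v ` A \<subseteq> R} = {x. rpt x - s \<in> lattice_hull B}"
    and G: "{v. (+) v ` B \<subseteq> R} = {x. rpt x - s \<in> lattice_hull A}"
    unfolding R_def using translates_below[OF pair_A_B] translates_below[OF pair_B_A] by simp_all
  have "R = {p \<in> R. free p} \<union> seeds" using seeds_below by (auto simp: R_def seeds_def)
  then have "card R = card ({p \<in> R. free p} \<union> seeds)" by simp
  also have "\<dots> = card {p \<in> R. free p} + card seeds"
    using finR finite_seeds by (intro card_Un_disjoint) (auto simp: seeds_def)
  finally show ?thesis
    using card_translates_below unfolding R_def[symmetric] F G R[symmetric] by simp
qed

end

subsection \<open>Averaging over the shift\<close>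

lemma AE_not_hyperplane:
  fixes n :: "real \<times> real"
  assumes "n \<noteq> 0"
  shows "AE s in lborel. n \<bullet> s \<noteq> k"
proof -
  have "{s. n \<bullet> s = k} \<in> null_sets lebesgue"
    using negligible_hyperplane[of n k] assms by (simp add: negligible_iff_null_sets)
  moreover have "{s. n \<bullet> s = k} \<in> sets lborel"
    using closed_hyperplane[of n k] borel_closed by simp
  ultimately have "{s. n \<bullet> s = k} \<in> null_sets lborel"
    using null_sets_completion_iff by blast
  then show ?thesis by (rule AE_I') auto
qed

text \<open>Genericity consists of countably many conditions, each of which excludes at most one
  line of shifts.\<close>

lemma AE_generic_shift:
  assumes fin: "finite A" "finite B"
  shows "AE s in lborel. generic_shift A B q s"
proof -
  let ?N = "normals A \<union> normals B" and ?Y = "clearance A B q"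
  have cN: "countable ?N" using finite_normals fin by (simp add: countable_finite)
  have cA: "countable A" "countable B" using fin by (simp_all add: countable_finite)
  have 1: "AE s in lborel. \<forall>a\<in>A. \<forall>b\<in>B. \<forall>x. rpt a + rpt b \<noteq> q \<longrightarrow>
      rot (rpt a + rpt b - q) \<bullet> (rpt x - (s + q)) \<noteq> 0"
    unfolding AE_ball_countable[OF cA(1)] AE_ball_countable[OF cA(2)] AE_all_countable
  proof (intro ballI allI)
    fix a b x
    show "AE s in lborel. rpt a + rpt b \<noteq> q \<longrightarrow> rot (rpt a + rpt b - q) \<bullet> (rpt x - (s + q)) \<noteq> 0"
    proof (cases "rpt a + rpt b = q")
      case False
      let ?n = "rot (rpt a + rpt b - q)"
      have "AE s in lborel. ?n \<bullet> s \<noteq> ?n \<bullet> (rpt x - q)"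
        using False by (intro AE_not_hyperplane) (simp add: rot_eq_0_iff)
      then show ?thesis by (rule AE_mp) (simp add: inner_diff_right inner_add_right)
    qed simp
  qed
  have 2: "AE s in lborel. \<forall>u\<in>?N. \<forall>u'\<in>?N. \<forall>x x'. ?Y u' *\<^sub>R u \<noteq> ?Y u *\<^sub>R u' \<longrightarrow>
      ?Y u' * (u \<bullet> (rpt x - (s + q))) \<noteq> ?Y u * (u' \<bullet> (rpt x' - (s + q)))"
    unfolding AE_ball_countable[OF cN] AE_all_countable
  proof (intro ballI allI)
    fix u u' x x'
    show "AE s in lborel. ?Y u' *\<^sub>R u \<noteq> ?Y u *\<^sub>R u' \<longrightarrow>
      ?Y u' * (u \<bullet> (rpt x - (s + q))) \<noteq> ?Y u * (u' \<bullet> (rpt x' - (s + q)))"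
    proof (cases "?Y u' *\<^sub>R u = ?Y u *\<^sub>R u'")
      case False
      have "AE s in lborel. (?Y u' *\<^sub>R u - ?Y u *\<^sub>R u') \<bullet> s \<noteq>
          ?Y u' * (u \<bullet> (rpt x - q)) - ?Y u * (u' \<bullet> (rpt x' - q))"
        using False by (intro AE_not_hyperplane) simp
      then show ?thesis
        by (rule AE_mp) (simp add: inner_diff_right inner_add_right inner_diff_left algebra_simps)
    qed simp
  qed
  have 3: "AE s in lborel. \<forall>u\<in>?N. \<forall>x. u \<bullet> (rpt x - (s + q)) \<noteq> ?Y u"
    unfolding AE_ball_countable[OF cN] AE_all_countable
  proof (intro ballI allI)
    fix u x assume "u \<in> ?N"
    then have "u \<noteq> 0" using normals_nonzero by blast
    then have "AE s in lborel. u \<bullet> s \<noteq> u \<bullet> (rpt x - q) - ?Y u" by (rule AE_not_hyperplane)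
    then show "AE s in lborel. u \<bullet> (rpt x - (s + q)) \<noteq> ?Y u"
      by (rule AE_mp) (simp add: inner_diff_right inner_add_right algebra_simps)
  qed
  show ?thesis unfolding generic_shift_def using 1 2 3 by eventually_elim blast
qed

definition unit_square :: "(real \<times> real) set" where
  "unit_square = {0..<1} \<times> {0..<1}"

lemma nn_integral_lborel_reflect:
  fixes f :: "real \<times> real \<Rightarrow> ennreal"
  assumes "f \<in> borel_measurable borel"
  shows "(\<integral>\<^sup>+ y. f y \<partial>lborel) = (\<integral>\<^sup>+ s. f (t - s) \<partial>lborel)"
proof -
  have "lborel = distr lborel borel (\<lambda>x. t + (-1) *\<^sub>R x)"
    using lborel_affine[of "-1" t] by (simp add: density_1)
  then have "(\<integral>\<^sup>+ y. f y \<partial>lborel) = (\<integral>\<^sup>+ y. f y \<partial>distr lborel borel (\<lambda>x. t + (-1) *\<^sub>R x))" by simp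
  also have "\<dots> = (\<integral>\<^sup>+ s. f (t - s) \<partial>lborel)"
    using assms by (subst nn_integral_distr) simp_all
  finally show ?thesis .
qed

lemma unit_square_measurable: "unit_square \<in> sets borel"
  unfolding unit_square_def by (intro borel_Times) auto

lemma emeasure_unit_square: "emeasure lborel unit_square = 1"
proof -
  have "emeasure lborel unit_square = emeasure (lborel \<Otimes>\<^sub>M lborel) ({0..<1::real} \<times> {0..<1::real})"
    unfolding unit_square_def lborel_prod ..
  also have "\<dots> = 1" by (subst lborel.emeasure_pair_measure_Times) auto
  finally show ?thesis .
qed

text \<open>The half-open squares \<open>rpt x - unit_square\<close> tile the plane, so each
  \<open>y\<close> belongs to exactly one of them.\<close>

lemma lattice_point_unit_square: "rpt x - y \<in> unit_square \<longleftrightarrow> x = (\<lceil>fst y\<rceil>, \<lceil>snd y\<rceil>)"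
proof -
  have "0 \<le> real_of_int m - r \<and> real_of_int m - r < 1 \<longleftrightarrow> m = \<lceil>r\<rceil>" for m :: int and r
    by linarith
  then show ?thesis by (cases x) (simp add: rpt_def unit_square_def mem_Times_iff)
qed

lemma norm_unit_square: "s \<in> unit_square \<Longrightarrow> norm s \<le> 2"
  using norm_Pair_le[of "fst s" "snd s"] by (auto simp: unit_square_def)

text \<open>Exchanging sum and integral and substituting \<open>y = rpt x - s\<close> cuts
  \<open>K\<close> into its pieces in the squares of the tiling.\<close>

lemma average_lattice_count:
  assumes K: "compact K"
  shows "(\<integral>\<^sup>+ s. ennreal (real (card {x. rpt x - s \<in> K})) * indicator unit_square s \<partial>lborel) = emeasure lborel K"
    and "(\<lambda>s. ennreal (real (card {x. rpt x - s \<in> K})) * indicator unit_square s) \<in> borel_measurable lborel"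
proof -
  obtain M where M: "\<And>y. y \<in> K \<Longrightarrow> norm y \<le> M"
    using compact_imp_bounded[OF K] by (auto simp: bounded_iff)
  \<comment> \<open>A finite set containing every lattice point that can be counted: points of
    \<open>K\<close> have norm at most \<open>M\<close>, shifts at most 2.\<close>
  define Z where "Z = {x. norm (rpt x - 0) \<le> M + 2}"
  have finZ: "finite Z" unfolding Z_def by (rule finite_bounded_lattice)
  have Kb: "K \<in> sets borel" using K borel_closed compact_imp_closed by blast
  have Z: "x \<in> Z" if "y \<in> K" "s \<in> unit_square" "rpt x = y + s" for x y s
    using that M[of y] norm_unit_square[of s] norm_triangle_ineq[of y s] by (simp add: Z_def)
  have count: "ennreal (real (card {x. rpt x - s \<in> K})) * indicator unit_square s =
      (\<Sum>x\<in>Z. indicator K (rpt x - s) * indicator unit_square s)" for s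
  proof (cases "s \<in> unit_square")
    case True
    have "{x. rpt x - s \<in> K} = {x\<in>Z. rpt x - s \<in> K}" using Z[OF _ True] by fastforce
    moreover have "(\<Sum>x\<in>Z. indicator K (rpt x - s) :: ennreal) = of_nat (card {x\<in>Z. rpt x - s \<in> K})"
      using finZ by (simp add: indicator_def sum.If_cases Collect_conj_eq Int_commute)
    ultimately show ?thesis using True by (simp add: ennreal_of_nat_eq_real_of_nat)
  qed simp
  have meas: "(\<lambda>s. indicator K (t - s) :: ennreal) \<in> borel_measurable borel" for t
    using Kb by measurable
  have measQ: "(\<lambda>y. indicator unit_square (t - y) :: ennreal) \<in> borel_measurable borel" for t
    using unit_square_measurable by measurable
  have measQ': "(indicator unit_square :: _ \<Rightarrow> ennreal) \<in> borel_measurable borel"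
    using unit_square_measurable by measurable
  have measK: "(indicator K :: _ \<Rightarrow> ennreal) \<in> borel_measurable borel"
    using Kb by measurable
  show "(\<lambda>s. ennreal (real (card {x. rpt x - s \<in> K})) * indicator unit_square s) \<in> borel_measurable lborel"
    unfolding count using meas measQ' by simp
  have "(\<integral>\<^sup>+ s. ennreal (real (card {x. rpt x - s \<in> K})) * indicator unit_square s \<partial>lborel) =
      (\<Sum>x\<in>Z. \<integral>\<^sup>+ s. indicator K (rpt x - s) * indicator unit_square s \<partial>lborel)"
    unfolding count using meas measQ' by (intro nn_integral_sum) simp
  also have "\<dots> = (\<Sum>x\<in>Z. \<integral>\<^sup>+ y. indicator K y * indicator unit_square (rpt x - y) \<partial>lborel)"
  proof (rule sum.cong[OF refl])
    fix x
    have "(\<integral>\<^sup>+ y. indicator K y * indicator unit_square (rpt x - y) \<partial>lborel) =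
        (\<integral>\<^sup>+ s. indicator K (rpt x - s) * indicator unit_square (rpt x - (rpt x - s)) \<partial>lborel)"
      using measK measQ by (intro nn_integral_lborel_reflect) simp
    then show "(\<integral>\<^sup>+ s. indicator K (rpt x - s) * indicator unit_square s \<partial>lborel) =
        (\<integral>\<^sup>+ y. indicator K y * indicator unit_square (rpt x - y) \<partial>lborel)" by simp
  qed
  also have "\<dots> = (\<integral>\<^sup>+ y. (\<Sum>x\<in>Z. indicator K y * indicator unit_square (rpt x - y)) \<partial>lborel)"
    using measK measQ by (intro nn_integral_sum[symmetric]) simp
  also have "\<dots> = (\<integral>\<^sup>+ y. indicator K y \<partial>lborel)"
  proof (rule nn_integral_cong)
    fix y
    show "(\<Sum>x\<in>Z. indicator K y * indicator unit_square (rpt x - y) :: ennreal) = indicator K y"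
    proof (cases "y \<in> K")
      case True
      let ?x = "(\<lceil>fst y\<rceil>, \<lceil>snd y\<rceil>)"
      have "?x \<in> Z" using Z[of y "rpt ?x - y" ?x] True lattice_point_unit_square[of ?x y] by simp
      moreover have "(indicator unit_square (rpt x - y) :: ennreal) = (if x = ?x then 1 else 0)" for x
        using lattice_point_unit_square[of x y] by (simp add: indicator_def)
      ultimately show ?thesis using True finZ by simp
    qed simp
  qed
  also have "\<dots> = emeasure lborel K" using Kb by simp
  finally show "(\<integral>\<^sup>+ s. ennreal (real (card {x. rpt x - s \<in> K})) * indicator unit_square s \<partial>lborel) = emeasure lborel K" .
qed

section \<open>The mixed volume as a seed number\<close>

text \<open>Otherwise the sum lies in a line with some normal \<open>u\<close>, which is then
  constant on \<open>A\<close> and on \<open>B\<close>; both top faces are the whole patterns,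
  against \<open>no_shared\<close>.\<close>

lemma interior_hull_sum_nonempty:
  assumes "finite A" "card A \<ge> 2" "finite B" "card B \<ge> 2"
    and no_shared: "\<And>u. u \<noteq> 0 \<Longrightarrow> (\<exists>a. top_face u A = {a}) \<or> (\<exists>b. top_face u B = {b})"
  shows "interior (lattice_hull A + lattice_hull B) \<noteq> {}"
proof
  assume "interior (lattice_hull A + lattice_hull B) = {}"
  then obtain u k where u: "u \<noteq> 0" "lattice_hull A + lattice_hull B \<subseteq> {x. u \<bullet> x = k}"
    using empty_interior_subset_hyperplane[OF convex_set_plus[OF convex_lattice_hull convex_lattice_hull]] by metis
  have uk: "u \<bullet> rpt a + u \<bullet> rpt b = k" if "a \<in> A" "b \<in> B" for a b
  proof -
    have "rpt a + rpt b \<in> lattice_hull A + lattice_hull B"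
      using that by (intro set_plus_intro rpt_in_lattice_hull)
    then show ?thesis using u(2) by (auto simp: inner_add_right)
  qed
  have ne: "A \<noteq> {}" "B \<noteq> {}" using assms by auto
  obtain a0 where a0: "a0 \<in> top_face u A" using top_face_nonempty assms ne by blast
  obtain b0 where b0: "b0 \<in> top_face u B" using top_face_nonempty assms ne by blast
  have mem: "a0 \<in> A" "b0 \<in> B" "u \<bullet> rpt a0 = support_value u A" "u \<bullet> rpt b0 = support_value u B"
    using a0 b0 unfolding top_face_def by blast+
  have "u \<bullet> rpt a = support_value u A" if "a \<in> A" for a
    using uk[OF that mem(2)] uk[OF mem(1,2)] mem(3) by linarith
  then have A: "top_face u A = A" unfolding top_face_def by blast
  have "u \<bullet> rpt b = support_value u B" if "b \<in> B" for b
    using uk[OF mem(1) that] uk[OF mem(1,2)] mem(4) by linarith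
  then have B: "top_face u B = B" unfolding top_face_def by blast
  have "A \<noteq> {a}" "B \<noteq> {a}" for a using assms(2,4) by auto
  then show False using no_shared[OF u(1)] A B by blast
qed

lemma shared_stable_direction_iff:
  assumes "finite A" "A \<noteq> {}" "finite B" "B \<noteq> {}"
  shows "(\<exists>u. shared_stable_direction A B u) \<longleftrightarrow>
    (\<exists>u. u \<noteq> 0 \<and> (\<nexists>a. top_face u A = {a}) \<and> (\<nexists>b. top_face u B = {b}))"
proof
  assume "\<exists>u. shared_stable_direction A B u"
  then obtain u where "norm u = 1" "\<nexists>a. top_face u A = {a}" "\<nexists>b. top_face u B = {b}"
    unfolding shared_stable_direction_def using outward_unit_normal_iff assms by blast
  then show "\<exists>u. u \<noteq> 0 \<and> (\<nexists>a. top_face u A = {a}) \<and> (\<nexists>b. top_face u B = {b})"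
    by (intro exI[of _ u]) auto
next
  assume "\<exists>u. u \<noteq> 0 \<and> (\<nexists>a. top_face u A = {a}) \<and> (\<nexists>b. top_face u B = {b})"
  then obtain u where u: "u \<noteq> 0" "\<nexists>a. top_face u A = {a}" "\<nexists>b. top_face u B = {b}" by blast
  let ?w = "(1 / norm u) *\<^sub>R u"
  have k: "0 < 1 / norm u" using u(1) by simp
  have "top_face ?w A = top_face u A" "top_face ?w B = top_face u B"
    using top_face_scaleR(1)[OF k] assms by blast+
  moreover have "norm ?w = 1" using u(1) by simp
  ultimately have "shared_stable_direction A B ?w"
    unfolding shared_stable_direction_def using outward_unit_normal_iff assms u(2,3) by simp
  then show "\<exists>u. shared_stable_direction A B u" by blast
qed

lemma smallest_seed_size_mix:
  assumes A: "finite A" "card A \<ge> 2" and B: "finite B" "card B \<ge> 2"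
    and no_shared: "\<And>u. u \<noteq> 0 \<Longrightarrow> (\<exists>a. top_face u A = {a}) \<or> (\<exists>b. top_face u B = {b})"
  shows "smallest_seed_size {A, B} (mix (lattice_hull A) (lattice_hull B))"
proof -
  let ?HA = "lattice_hull A" and ?HB = "lattice_hull B"
  have ne: "A \<noteq> {}" "B \<noteq> {}" using A B by auto
  obtain q where q: "q \<in> interior (?HA + ?HB)"
    using interior_hull_sum_nonempty[OF A B no_shared] by blast
  have pair: "generic_pair A B q s" if "generic_shift A B q s" for s
    by unfold_locales (use A B ne no_shared q that in auto)
  have AE: "AE s in lborel. generic_shift A B q s" using AE_generic_shift A B by blast
  \<comment> \<open>The measure is not zero, so a condition that holds almost everywhere holds
    somewhere.\<close>
  have "ae_filter (lborel :: (real \<times> real) measure) \<noteq> bot" by (simp add: ae_filter_eq_bot_iff)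
  then obtain s0 where s0: "generic_shift A B q s0" using eventually_happens'[OF _ AE] by blast
  interpret s0: generic_pair A B q s0 by (rule pair[OF s0])
  define m where "m = card s0.seeds"
  \<comment> \<open>The seeds of any two generic shifts percolate and each set is minimal, so their
    sizes agree.\<close>
  have m: "card (generic_pair.seeds A B q s) = m" if "generic_shift A B q s" for s
  proof -
    interpret s: generic_pair A B q s by (rule pair[OF that])
    show ?thesis
      unfolding m_def
      using s.card_seeds_le[OF s0.finite_seeds s0.percolates_seeds]
        s0.card_seeds_le[OF s.finite_seeds s.percolates_seeds] by simp
  qed
  let ?N = "\<lambda>K s. ennreal (real (card {x. rpt x - s \<in> K})) * indicator unit_square s"
  have compact: "compact ?HA" "compact ?HB" using compact_lattice_hull A B by blast+
  have compact_sum: "compact (?HA + ?HB)" using s0.compact_X by (simp add: s0.X_def)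
  \<comment> \<open>The constant \<open>m\<close> integrates to itself over the unit square, while
    the lattice counts integrate to areas.\<close>
  have N: "?N (?HA + ?HB) s = ennreal (real m) * indicator unit_square s + (?N ?HA s + ?N ?HB s)"
    if "generic_shift A B q s" for s
  proof -
    have "card {x. rpt x - s \<in> ?HA + ?HB} = m + (card {x. rpt x - s \<in> ?HA} + card {x. rpt x - s \<in> ?HB})"
      using generic_pair.card_seeds[OF pair[OF that]] m[OF that] by simp
    then show ?thesis by (simp add: ennreal_plus algebra_simps)
  qed
  have measQ: "(\<lambda>s. ennreal (real m) * indicator unit_square s) \<in> borel_measurable lborel"
    using unit_square_measurable by measurable
  have "emeasure lborel (?HA + ?HB) = (\<integral>\<^sup>+ s. ?N (?HA + ?HB) s \<partial>lborel)"
    by (rule average_lattice_count(1)[OF compact_sum, symmetric])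
  also have "\<dots> = (\<integral>\<^sup>+ s. ennreal (real m) * indicator unit_square s + (?N ?HA s + ?N ?HB s) \<partial>lborel)"
    using AE N by (intro nn_integral_cong_AE) (auto elim: eventually_mono)
  also have "\<dots> = (\<integral>\<^sup>+ s. ennreal (real m) * indicator unit_square s \<partial>lborel) +
      ((\<integral>\<^sup>+ s. ?N ?HA s \<partial>lborel) + (\<integral>\<^sup>+ s. ?N ?HB s \<partial>lborel))"
    using measQ average_lattice_count(2)[OF compact(1)] average_lattice_count(2)[OF compact(2)]
    by (simp add: nn_integral_add)
  also have "\<dots> = ennreal (real m) + (emeasure lborel ?HA + emeasure lborel ?HB)"
    using average_lattice_count(1) compact unit_square_measurable emeasure_unit_square
    by (simp add: nn_integral_cmult)
  finally have "emeasure lborel (?HA + ?HB) = ennreal (real m) + (emeasure lborel ?HA + emeasure lborel ?HB)" .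
  moreover have "emeasure lborel K = ennreal (measure lborel K)" if "compact K" for K :: "(real \<times> real) set"
    using emeasure_compact_finite[OF that] by (simp add: emeasure_eq_ennreal_measure)
  ultimately have "ennreal (measure lborel (?HA + ?HB)) =
      ennreal (real m + (measure lborel ?HA + measure lborel ?HB))"
    using compact compact_sum by (simp add: ennreal_plus)
  then have "measure lborel (?HA + ?HB) = real m + (measure lborel ?HA + measure lborel ?HB)"
    by (subst (asm) ennreal_inj) simp_all
  then have "mix ?HA ?HB = real m" by (simp add: mix_def)
  then show ?thesis
    unfolding smallest_seed_size_def m_def
    using s0.finite_seeds s0.percolates_seeds s0.card_seeds_le by auto
qed

theorem theorem2:
  fixes A B :: "(int \<times> int) set"
  assumes "finite A" and "card A \<ge> 2"
    and "finite B" and "card B \<ge> 2"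
    and "\<nexists>v. B = (+) v ` A"
  shows "((\<nexists>u. shared_stable_direction A B u) \<longrightarrow>
            smallest_seed_size {A, B} (mix (lattice_hull A) (lattice_hull B))) \<and>
         ((\<exists>u. shared_stable_direction A B u) \<longrightarrow>
            (\<nexists>S. finite S \<and> percolates {A, B} S))"
proof -
  have ne: "A \<noteq> {}" "B \<noteq> {}" using assms by auto
  note shared = shared_stable_direction_iff[OF assms(1) ne(1) assms(3) ne(2)]
  show ?thesis
  proof (intro conjI impI)
    assume "\<nexists>u. shared_stable_direction A B u"
    then show "smallest_seed_size {A, B} (mix (lattice_hull A) (lattice_hull B))"
      unfolding shared by (intro smallest_seed_size_mix assms) blast
  next
    assume "\<exists>u. shared_stable_direction A B u"
    then obtain u where "u \<noteq> 0" "\<nexists>a. top_face u A = {a}" "\<nexists>b. top_face u B = {b}"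
      unfolding shared by blast
    then show "\<nexists>S. finite S \<and> percolates {A, B} S"
      using no_finite_seed[of "{A, B}" u] assms by blast
  qed
qed

end
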